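(* Let $G$ be a finite group, $S\subseteq G$ a subgroup, $\alpha\in Z^2(S,k^* )$ a non-degenerate 2-cocycle, $A=A(G,S,\alpha)$ the associated $k^G$-Galois object, and $F\subseteq G$ any subgroup. Then the subalgebra of invariants $A^F$ is a $k^G$-submodule of $A$ with respect to the Miyashita-Ulbrich action if and only if for every $(\alpha,F)$-regular class $(g,s)\in G\times_S S$ one has $g^{-1}Fg\subseteq C_G(s)$.
   Context: $k$ is an algebraically closed field of characteristic zero. $k^G$ is the Hopf algebra of functions on $G$, with basis of idempotents $e_g$, $e_g(h)=\delta_{g,h}$. For a 2-cocycle $\alpha$ on $S$ (trivial action on $k^*$), $k_\alpha S$ is the twisted group algebra with basis $(x_s)_{s\in S}$, $x_sx_t=\alpha(s,t)x_{st}$; $\alpha$ is non-degenerate if $1$ is the only $s\in S$ with $\alpha(s,t)=\alpha(t,s)$ for all $t\in C_S(s)$. Standing normalization (possible up to cohomology): $\alpha(s,s^{-1})=1$ for all $s\in S$. $A(G,S,\alpha)=\{f:G\to k_\alpha S : f(sg)=s\rhd f(g)\ \forall s\in S,g\in G\}$ with pointwise product, $s\rhd x_t=x_sx_tx_s^{-1}$, and $G$-action $(g.f)(h)=f(hg)$. It is a right $k^G$-Galois object via $\rho(a)=\sum_{g}g.a\otimes e_g$, i.e. $A^{\mathrm{co}\,k^G}=k$ and $A\otimes A\to A\otimes k^G$, $x\otimes y\mapsto xy_{(0)}\otimes y_{(1)}$, is bijective. $A^F$ is the subalgebra of elements fixed by $F$. The Miyashita-Ulbrich action of $H$ on an $H$-Galois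 object $A$ is the unique map $A\otimes H\to A$, $x\otimes h\mapsto x\leftharpoonup h$, such that $xy=y_{(0)}(x\leftharpoonup y_{(1)})$ for all $x,y\in A$. For $H=k^G$ it amounts to a $G$-grading $A=\bigoplus_{g\in G}A_g$ with $A_g=A\leftharpoonup e_g=\{a\in A: ax=(g.x)a\ \forall x\in A\}$. $G\times_S S$ is the quotient of $G\times S$ by the equivalence relation $(g,s)\sim(gt^{-1},tst^{-1})$, $t\in S$. A class $(g,s)\in G\times_S S$ is $(\alpha,F)$-regular if $\alpha(s,t)=\alpha(t,s)$ for all $t\in C_S(s)\cap g^{-1}Fg$ (this depends only on the class). *)

theory Defs
  imports
    "HOL-Computational_Algebra.Polynomial"
    "HOL-Algebra.Coset"
    "HOL-Algebra.Module"
begin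

text \<open>
  The ground field is a type \<open>'k\<close>; every function on a group or subgroup is taken to be
  extensional (\<open>undefined\<close> outside its domain), so that equality of functions is the
  mathematical one.  Algebras over \<open>'k\<close> are \<open>module\<close> records, with \<open>\<odot>\<close> the scalar
  multiplication.
\<close>

section \<open>Cocycles and twisted group algebras\<close>

definition centralizer :: "('g, 'm) monoid_scheme \<Rightarrow> 'g set \<Rightarrow> 'g \<Rightarrow> 'g set" where
  "centralizer G X s = {t \<in> X. t \<otimes>\<^bsub>G\<^esub> s = s \<otimes>\<^bsub>G\<^esub> t}"

text \<open>\<open>\<alpha> \<in> Z\<^sup>2(S, k\<^sup>*)\<close> for the trivial action.\<close>

definition two_cocycle ::
    "('g, 'm) monoid_scheme \<Rightarrow> 'g set \<Rightarrow> ('g \<Rightarrow> 'g \<Rightarrow> 'k::field) \<Rightarrow> bool" where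
  "two_cocycle G S \<alpha> \<longleftrightarrow>
     (\<forall>s\<in>S. \<forall>t\<in>S. \<alpha> s t \<noteq> 0) \<and>
     (\<forall>r\<in>S. \<forall>s\<in>S. \<forall>t\<in>S.
        \<alpha> r s * \<alpha> (r \<otimes>\<^bsub>G\<^esub> s) t = \<alpha> s t * \<alpha> r (s \<otimes>\<^bsub>G\<^esub> t))"

definition normalized_cocycle ::
    "('g, 'm) monoid_scheme \<Rightarrow> 'g set \<Rightarrow> ('g \<Rightarrow> 'g \<Rightarrow> 'k::field) \<Rightarrow> bool" where
  "normalized_cocycle G S \<alpha> \<longleftrightarrow> (\<forall>s\<in>S. \<alpha> s (inv\<^bsub>G\<^esub> s) = 1)"

definition nondegenerate_cocycle ::
    "('g, 'm) monoid_scheme \<Rightarrow> 'g set \<Rightarrow> ('g \<Rightarrow> 'g \<Rightarrow> 'k::field) \<Rightarrow> bool" where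
  "nondegenerate_cocycle G S \<alpha> \<longleftrightarrow>
     {s \<in> S. \<forall>t \<in> centralizer G S s. \<alpha> s t = \<alpha> t s} = {\<one>\<^bsub>G\<^esub>}"

text \<open>
  An element \<open>\<Sum>\<^sub>s a\<^sub>s x\<^sub>s\<close> of \<open>k\<^sub>\<alpha> S\<close> is encoded by its coefficient function \<open>s \<mapsto> a\<^sub>s\<close>.  For a
  cocycle that need not be normalized the unit is \<open>\<alpha>(1,1)\<^sup>-\<^sup>1 x\<^sub>1\<close>.
\<close>

definition twisted_group_algebra ::
    "('g, 'm) monoid_scheme \<Rightarrow> 'g set \<Rightarrow> ('g \<Rightarrow> 'g \<Rightarrow> 'k::field) \<Rightarrow> ('k, 'g \<Rightarrow> 'k) module" where
  "twisted_group_algebra G S \<alpha> =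
     \<lparr>carrier = S \<rightarrow>\<^sub>E UNIV,
      mult = \<lambda>a b. \<lambda>u\<in>S. \<Sum>(s, t) \<in> {(s, t) \<in> S \<times> S. s \<otimes>\<^bsub>G\<^esub> t = u}. a s * b t * \<alpha> s t,
      one = \<lambda>u\<in>S. if u = \<one>\<^bsub>G\<^esub> then inverse (\<alpha> \<one>\<^bsub>G\<^esub> \<one>\<^bsub>G\<^esub>) else 0,
      zero = \<lambda>u\<in>S. 0,
      add = \<lambda>a b. \<lambda>u\<in>S. a u + b u,
      smult = \<lambda>c a. \<lambda>u\<in>S. c * a u\<rparr>"

definition tga_basis :: "'g set \<Rightarrow> 'g \<Rightarrow> 'g \<Rightarrow> 'k::field" where
  "tga_basis S s = (\<lambda>u\<in>S. if u = s then 1 else 0)"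

text \<open>\<open>s \<rhd> a = x\<^sub>s a x\<^sub>s\<^sup>-\<^sup>1\<close>, the inverse being taken in \<open>k\<^sub>\<alpha> S\<close>.\<close>

definition tga_conj ::
    "('g, 'm) monoid_scheme \<Rightarrow> 'g set \<Rightarrow> ('g \<Rightarrow> 'g \<Rightarrow> 'k::field) \<Rightarrow> 'g \<Rightarrow> ('g \<Rightarrow> 'k) \<Rightarrow> 'g \<Rightarrow> 'k"
  where
  "tga_conj G S \<alpha> s a =
     (let R = twisted_group_algebra G S \<alpha>
      in tga_basis S s \<otimes>\<^bsub>R\<^esub> a \<otimes>\<^bsub>R\<^esub> inv\<^bsub>R\<^esub> (tga_basis S s))"

section \<open>The Galois object\<close>

definition galois_object ::
    "('g, 'm) monoid_scheme \<Rightarrow> 'g set \<Rightarrow> ('g \<Rightarrow> 'g \<Rightarrow> 'k::field) \<Rightarrow> ('k, 'g \<Rightarrow> 'g \<Rightarrow> 'k) module"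
  where
  "galois_object G S \<alpha> =
     (let R = twisted_group_algebra G S \<alpha> in
      \<lparr>carrier = {f \<in> carrier G \<rightarrow>\<^sub>E carrier R.
                   \<forall>s\<in>S. \<forall>g\<in>carrier G. f (s \<otimes>\<^bsub>G\<^esub> g) = tga_conj G S \<alpha> s (f g)},
       mult = \<lambda>f f'. \<lambda>g\<in>carrier G. f g \<otimes>\<^bsub>R\<^esub> f' g,
       one = \<lambda>g\<in>carrier G. \<one>\<^bsub>R\<^esub>,
       zero = \<lambda>g\<in>carrier G. \<zero>\<^bsub>R\<^esub>,
       add = \<lambda>f f'. \<lambda>g\<in>carrier G. f g \<oplus>\<^bsub>R\<^esub> f' g,
       smult = \<lambda>c f. \<lambda>g\<in>carrier G. c \<odot>\<^bsub>R\<^esub> f g\<rparr>)"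

definition translate :: "('g, 'm) monoid_scheme \<Rightarrow> 'g \<Rightarrow> ('g \<Rightarrow> 'a) \<Rightarrow> 'g \<Rightarrow> 'a" where
  "translate G g f = (\<lambda>h\<in>carrier G. f (h \<otimes>\<^bsub>G\<^esub> g))"

definition invariants :: "('k, 'a) module \<Rightarrow> ('g \<Rightarrow> 'a \<Rightarrow> 'a) \<Rightarrow> 'g set \<Rightarrow> 'a set" where
  "invariants A act F = {a \<in> carrier A. \<forall>g\<in>F. act g a = a}"

section \<open>The Miyashita-Ulbrich action\<close>

definition function_algebra :: "('g, 'm) monoid_scheme \<Rightarrow> ('k::field, 'g \<Rightarrow> 'k) module" where
  "function_algebra G =
     \<lparr>carrier = carrier G \<rightarrow>\<^sub>E UNIV,
      mult = \<lambda>p q. \<lambda>g\<in>carrier G. p g * q g,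
      one = \<lambda>g\<in>carrier G. 1,
      zero = \<lambda>g\<in>carrier G. 0,
      add = \<lambda>p q. \<lambda>g\<in>carrier G. p g + q g,
      smult = \<lambda>c p. \<lambda>g\<in>carrier G. c * p g\<rparr>"

definition fun_idem :: "('g, 'm) monoid_scheme \<Rightarrow> 'g \<Rightarrow> 'g \<Rightarrow> 'k::field" where
  "fun_idem G g = (\<lambda>h\<in>carrier G. if h = g then 1 else 0)"

text \<open>
  Let \<open>A\<close> be an algebra on which \<open>G\<close> acts by \<open>act\<close>, with corresponding \<open>k\<^sup>G\<close>-coaction
  \<open>y\<^sub>(\<^sub>0\<^sub>) \<otimes> y\<^sub>(\<^sub>1\<^sub>) = \<Sum>\<^sub>g g.y \<otimes> e\<^sub>g\<close>.  The identity \<open>xy = y\<^sub>(\<^sub>0\<^sub>)(x \<leftharpoonup> y\<^sub>(\<^sub>1\<^sub>))\<close> then reads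
  \<open>xy = \<Sum>\<^sub>g (g.y)(x \<leftharpoonup> e\<^sub>g)\<close>; a linear map on \<open>A \<otimes> k\<^sup>G\<close> is given as a bilinear map.
\<close>

definition is_miyashita_ulbrich ::
    "('g, 'm) monoid_scheme \<Rightarrow> ('k::field, 'a) module \<Rightarrow> ('g \<Rightarrow> 'a \<Rightarrow> 'a)
      \<Rightarrow> ('a \<Rightarrow> ('g \<Rightarrow> 'k) \<Rightarrow> 'a) \<Rightarrow> bool" where
  "is_miyashita_ulbrich G A act \<mu> \<longleftrightarrow>
     (let H = function_algebra G in
      \<mu> \<in> carrier A \<rightarrow>\<^sub>E carrier H \<rightarrow>\<^sub>E carrier A \<and>
      (\<forall>x\<in>carrier A. \<forall>y\<in>carrier A. \<forall>p\<in>carrier H. \<mu> (x \<oplus>\<^bsub>A\<^esub> y) p = \<mu> x p \<oplus>\<^bsub>A\<^esub> \<mu> y p) \<and>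
      (\<forall>x\<in>carrier A. \<forall>p\<in>carrier H. \<forall>q\<in>carrier H. \<mu> x (p \<oplus>\<^bsub>H\<^esub> q) = \<mu> x p \<oplus>\<^bsub>A\<^esub> \<mu> x q) \<and>
      (\<forall>c. \<forall>x\<in>carrier A. \<forall>p\<in>carrier H. \<mu> (c \<odot>\<^bsub>A\<^esub> x) p = c \<odot>\<^bsub>A\<^esub> \<mu> x p) \<and>
      (\<forall>c. \<forall>x\<in>carrier A. \<forall>p\<in>carrier H. \<mu> x (c \<odot>\<^bsub>H\<^esub> p) = c \<odot>\<^bsub>A\<^esub> \<mu> x p) \<and>
      (\<forall>x\<in>carrier A. \<forall>y\<in>carrier A.
         x \<otimes>\<^bsub>A\<^esub> y = (\<Oplus>\<^bsub>A\<^esub>g\<in>carrier G. act g y \<otimes>\<^bsub>A\<^esub> \<mu> x (fun_idem G g))))"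

definition miyashita_ulbrich ::
    "('g, 'm) monoid_scheme \<Rightarrow> ('k::field, 'a) module \<Rightarrow> ('g \<Rightarrow> 'a \<Rightarrow> 'a)
      \<Rightarrow> 'a \<Rightarrow> ('g \<Rightarrow> 'k) \<Rightarrow> 'a" where
  "miyashita_ulbrich G A act = (THE \<mu>. is_miyashita_ulbrich G A act \<mu>)"

text \<open>
  \<open>A\<close> as a module over \<open>k\<^sup>G\<close> by the Miyashita-Ulbrich action.  As \<open>k\<^sup>G\<close> is commutative, the
  right module is written as a left one.
\<close>

definition miyashita_ulbrich_module ::
    "('g, 'm) monoid_scheme \<Rightarrow> ('k::field, 'a) module \<Rightarrow> ('g \<Rightarrow> 'a \<Rightarrow> 'a)
      \<Rightarrow> ('g \<Rightarrow> 'k, 'a) module" where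
  "miyashita_ulbrich_module G A act =
     \<lparr>carrier = carrier A, mult = mult A, one = one A, zero = zero A, add = add A,
      smult = \<lambda>p x. miyashita_ulbrich G A act x p\<rparr>"

section \<open>Regular classes\<close>

definition balanced_rel :: "('g, 'm) monoid_scheme \<Rightarrow> 'g set \<Rightarrow> (('g \<times> 'g) \<times> ('g \<times> 'g)) set" where
  "balanced_rel G S =
     {((g, s), (g \<otimes>\<^bsub>G\<^esub> inv\<^bsub>G\<^esub> t, t \<otimes>\<^bsub>G\<^esub> s \<otimes>\<^bsub>G\<^esub> inv\<^bsub>G\<^esub> t)) | g s t.
        g \<in> carrier G \<and> s \<in> S \<and> t \<in> S}"

text \<open>\<open>G \<times>\<^sub>S S\<close>\<close>

definition balanced_product :: "('g, 'm) monoid_scheme \<Rightarrow> 'g set \<Rightarrow> ('g \<times> 'g) set set" where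
  "balanced_product G S = (carrier G \<times> S) // balanced_rel G S"

definition conj_subgroup :: "('g, 'm) monoid_scheme \<Rightarrow> 'g set \<Rightarrow> 'g \<Rightarrow> 'g set" where
  "conj_subgroup G F g = (\<lambda>x. inv\<^bsub>G\<^esub> g \<otimes>\<^bsub>G\<^esub> x \<otimes>\<^bsub>G\<^esub> g) ` F"

text \<open>The condition depends only on the class, so it is required of all representatives.\<close>

definition regular_class ::
    "('g, 'm) monoid_scheme \<Rightarrow> 'g set \<Rightarrow> ('g \<Rightarrow> 'g \<Rightarrow> 'k::field) \<Rightarrow> 'g set \<Rightarrow> ('g \<times> 'g) set \<Rightarrow> bool"
  where
  "regular_class G S \<alpha> F C \<longleftrightarrow>
     (\<forall>(g, s)\<in>C. \<forall>t \<in> centralizer G S s \<inter> conj_subgroup G F g. \<alpha> s t = \<alpha> t s)"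

end

theory Submission
  imports Defs
begin

text \<open>
  Writing elements of the Galois object as coefficient functions \<open>x(g, u)\<close> on \<open>G \<times> S\<close>, the
  Miyashita-Ulbrich action becomes \<open>(x \<leftharpoonup> p)(g, u) = x(g, u) p(g\<^sup>-\<^sup>1 u g)\<close>.  Hence the
  invariants are a submodule if and only if \<open>g\<^sup>-\<^sup>1 u g\<close> commutes with \<open>F\<close> whenever some
  \<open>F\<close>-invariant \<open>x\<close> has \<open>x(g, u) \<noteq> 0\<close>.  The invariants are the functions that are equivariant
  (up to a scalar twist) under \<open>S \<times> F\<close> acting on \<open>G \<times> S\<close>; such a function can be nonzero at
  \<open>(g, u)\<close> exactly if the twist is trivial on the stabilizer of \<open>(g, u)\<close>, which is regularity
  of the class of \<open>(g\<^sup>-\<^sup>1, u)\<close>.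
\<close>

section \<open>Normalized cocycles and coefficient formulas in the twisted group algebra\<close>

locale cocycle_on_subgroup = group G
  for G :: "('g, 'm) monoid_scheme" (structure) +
  fixes S :: "'g set" and \<alpha> :: "'g \<Rightarrow> 'g \<Rightarrow> 'k::field_char_0"
  assumes finite_carrier: "finite (carrier G)"
    and subgroup_S: "subgroup S G"
    and cocycle: "two_cocycle G S \<alpha>"
    and normalized: "normalized_cocycle G S \<alpha>"
begin

abbreviation R where "R \<equiv> twisted_group_algebra G S \<alpha>"
abbreviation A where "A \<equiv> galois_object G S \<alpha>"
abbreviation H :: "('k, 'g \<Rightarrow> 'k) module" where "H \<equiv> function_algebra G"

lemma S_carrier [simp]: "s \<in> S \<Longrightarrow> s \<in> carrier G"
  using subgroup_S subgroup.subset by blast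

lemma S_closed [simp]:
  "s \<in> S \<Longrightarrow> t \<in> S \<Longrightarrow> s \<otimes> t \<in> S" "s \<in> S \<Longrightarrow> inv s \<in> S" "\<one> \<in> S"
  using subgroup_S by (auto intro: subgroup.m_closed subgroup.m_inv_closed subgroup.one_closed)

lemma finite_S [simp]: "finite S"
  using finite_carrier finite_subset subgroup_S subgroup.subset by blast

lemma mult_inv_cancel [simp]:
  assumes "x \<in> carrier G" "y \<in> carrier G"
  shows "inv x \<otimes> (x \<otimes> y) = y" "x \<otimes> (inv x \<otimes> y) = y"
  using assms by (simp_all flip: m_assoc)

lemmas group_word_simps = m_assoc inv_mult_group

lemma cocycle_nonzero [simp]: "s \<in> S \<Longrightarrow> t \<in> S \<Longrightarrow> \<alpha> s t \<noteq> 0"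
  using cocycle by (auto simp: two_cocycle_def)

lemma cocycle_eq:
  "r \<in> S \<Longrightarrow> s \<in> S \<Longrightarrow> t \<in> S \<Longrightarrow> \<alpha> r s * \<alpha> (r \<otimes> s) t = \<alpha> s t * \<alpha> r (s \<otimes> t)"
  using cocycle by (auto simp: two_cocycle_def)

lemma cocycle_inv_right [simp]: "s \<in> S \<Longrightarrow> \<alpha> s (inv s) = 1"
  using normalized by (auto simp: normalized_cocycle_def)

lemma cocycle_inv_left [simp]: "s \<in> S \<Longrightarrow> \<alpha> (inv s) s = 1"
  using cocycle_inv_right[of "inv s"] by simp

lemma cocycle_one_one [simp]: "\<alpha> \<one> \<one> = 1"
  using cocycle_inv_right[of \<one>] by simp

lemma cocycle_one_right [simp]: "s \<in> S \<Longrightarrow> \<alpha> s \<one> = 1"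
  using cocycle_eq[of s \<one> \<one>] by simp

lemma cocycle_one_left [simp]: "s \<in> S \<Longrightarrow> \<alpha> \<one> s = 1"
  using cocycle_eq[of \<one> \<one> s] by simp

lemma tga_mult_apply:
  assumes "u \<in> S"
  shows "(a \<otimes>\<^bsub>R\<^esub> b) u = (\<Sum>s\<in>S. a s * b (inv s \<otimes> u) * \<alpha> s (inv s \<otimes> u))"
proof -
  have "(\<Sum>(s, t) \<in> {(s, t) \<in> S \<times> S. s \<otimes> t = u}. a s * b t * \<alpha> s t)
    = (\<Sum>s\<in>S. a s * b (inv s \<otimes> u) * \<alpha> s (inv s \<otimes> u))"
    by (rule sum.reindex_bij_witness[of _ "\<lambda>s. (s, inv s \<otimes> u)" fst]) (use assms in auto)
  then show ?thesis
    using assms by (simp add: twisted_group_algebra_def)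
qed

lemma tga_mult_closed [simp]: "a \<otimes>\<^bsub>R\<^esub> b \<in> carrier R"
  by (auto simp: twisted_group_algebra_def)

lemma tga_basis_closed [simp]: "tga_basis S s \<in> carrier R"
  by (auto simp: twisted_group_algebra_def tga_basis_def)

lemma tga_basis_mult_left:
  assumes "s \<in> S" "u \<in> S"
  shows "(tga_basis S s \<otimes>\<^bsub>R\<^esub> b) u = b (inv s \<otimes> u) * \<alpha> s (inv s \<otimes> u)"
proof -
  have "(tga_basis S s \<otimes>\<^bsub>R\<^esub> b) u
      = (\<Sum>t\<in>S. if t = s then b (inv s \<otimes> u) * \<alpha> s (inv s \<otimes> u) else 0)"
    unfolding tga_mult_apply[OF assms(2)] by (rule sum.cong) (auto simp: tga_basis_def)
  then show ?thesis using assms by simp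
qed

lemma tga_basis_mult_right:
  assumes "s \<in> S" "u \<in> S"
  shows "(a \<otimes>\<^bsub>R\<^esub> tga_basis S s) u = a (u \<otimes> inv s) * \<alpha> (u \<otimes> inv s) s"
proof -
  have *: "inv t \<otimes> u = s \<longleftrightarrow> t = u \<otimes> inv s" if "t \<in> S" for t
    using that assms by (auto simp: group_word_simps)
  have "(a \<otimes>\<^bsub>R\<^esub> tga_basis S s) u
      = (\<Sum>t\<in>S. if t = u \<otimes> inv s then a (u \<otimes> inv s) * \<alpha> (u \<otimes> inv s) s else 0)"
    unfolding tga_mult_apply[OF assms(2)]
    by (rule sum.cong) (use assms in \<open>auto simp: tga_basis_def * group_word_simps\<close>)
  then show ?thesis using assms by simp
qed

lemma tga_one_apply: "u \<in> S \<Longrightarrow> \<one>\<^bsub>R\<^esub> u = (if u = \<one> then 1 else 0)"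
  by (simp add: twisted_group_algebra_def)

lemma tga_carrier_eqI:
  assumes "a \<in> carrier R" "b \<in> carrier R" "\<And>u. u \<in> S \<Longrightarrow> a u = b u"
  shows "a = b"
  using assms by (auto simp: twisted_group_algebra_def intro: PiE_ext)

text \<open>Normalization turns the product of the basis elements for s and s^-1 into the one for 1,
  which is the unit because \<alpha>(1,1) = 1. Since \<open>m_inv\<close> is a definite description,
  uniqueness has to be shown too; it comes from comparing coefficients.\<close>

lemma tga_basis_inv:
  assumes "s \<in> S"
  shows "inv\<^bsub>R\<^esub> (tga_basis S s) = tga_basis S (inv s)"
  unfolding m_inv_def[of R]
proof (rule the_equality)
  have one: "\<one>\<^bsub>R\<^esub> \<in> carrier R"
    by (simp add: twisted_group_algebra_def)
  have 1: "tga_basis S s \<otimes>\<^bsub>R\<^esub> tga_basis S (inv s) = \<one>\<^bsub>R\<^esub>"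
  proof (rule tga_carrier_eqI[OF tga_mult_closed one])
    fix u assume u: "u \<in> S"
    then have "inv s \<otimes> u = inv s \<longleftrightarrow> u = \<one>"
      using assms by auto
    then show "(tga_basis S s \<otimes>\<^bsub>R\<^esub> tga_basis S (inv s)) u = \<one>\<^bsub>R\<^esub> u"
      using u assms by (simp add: tga_basis_mult_left tga_one_apply) (simp add: tga_basis_def)
  qed
  have 2: "tga_basis S (inv s) \<otimes>\<^bsub>R\<^esub> tga_basis S s = \<one>\<^bsub>R\<^esub>"
  proof (rule tga_carrier_eqI[OF tga_mult_closed one])
    fix u assume u: "u \<in> S"
    then have "s \<otimes> u = s \<longleftrightarrow> u = \<one>"
      using assms by auto
    then show "(tga_basis S (inv s) \<otimes>\<^bsub>R\<^esub> tga_basis S s) u = \<one>\<^bsub>R\<^esub> u"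
      using u assms by (simp add: tga_basis_mult_left tga_one_apply) (simp add: tga_basis_def)
  qed
  show "tga_basis S (inv s) \<in> carrier R
      \<and> tga_basis S s \<otimes>\<^bsub>R\<^esub> tga_basis S (inv s) = \<one>\<^bsub>R\<^esub>
      \<and> tga_basis S (inv s) \<otimes>\<^bsub>R\<^esub> tga_basis S s = \<one>\<^bsub>R\<^esub>"
    using 1 2 by simp
next
  fix y assume y: "y \<in> carrier R
      \<and> tga_basis S s \<otimes>\<^bsub>R\<^esub> y = \<one>\<^bsub>R\<^esub> \<and> y \<otimes>\<^bsub>R\<^esub> tga_basis S s = \<one>\<^bsub>R\<^esub>"
  show "y = tga_basis S (inv s)"
  proof (rule tga_carrier_eqI)
    fix u assume u: "u \<in> S"
    \<comment> \<open>The coefficient at \<open>s \<otimes> u\<close> involves the single value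
      \<open>y u\<close>, so a right inverse is determined.\<close>
    have "(tga_basis S s \<otimes>\<^bsub>R\<^esub> y) (s \<otimes> u) = \<one>\<^bsub>R\<^esub> (s \<otimes> u)"
      using y by simp
    then have *: "y u * \<alpha> s u = (if s \<otimes> u = \<one> then 1 else 0)"
      using u assms by (simp add: tga_basis_mult_left tga_one_apply)
    have "s \<otimes> u = \<one> \<longleftrightarrow> u = inv s"
      using u assms by (metis S_carrier inv_equality inv_inv r_inv inv_closed)
    with * show "y u = tga_basis S (inv s) u"
      using u assms by (auto simp: tga_basis_def)
  qed (use y in simp_all)
qed

section \<open>The scalars of conjugation by basis elements\<close>

text \<open>\<open>x\<^sub>s x\<^sub>v x\<^sub>s\<^sup>-\<^sup>1 = \<chi>(s, v) x\<^bsub>s v s\<^sup>-\<^sup>1\<^esub>\<close>\<close>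

definition \<chi> :: "'g \<Rightarrow> 'g \<Rightarrow> 'k" where
  "\<chi> s v = \<alpha> s v * \<alpha> (s \<otimes> v) (inv s)"

lemma tga_conj_apply:
  assumes "s \<in> S" "u \<in> S"
  shows "tga_conj G S \<alpha> s a u = \<chi> s (inv s \<otimes> u \<otimes> s) * a (inv s \<otimes> u \<otimes> s)"
  using assms
  by (simp add: tga_conj_def Let_def tga_basis_inv tga_basis_mult_right tga_basis_mult_left
      \<chi>_def group_word_simps)

lemma chi_nonzero [simp]: "s \<in> S \<Longrightarrow> v \<in> S \<Longrightarrow> \<chi> s v \<noteq> 0"
  by (simp add: \<chi>_def)

lemma chi_one_right [simp]: "s \<in> S \<Longrightarrow> \<chi> s \<one> = 1"
  by (simp add: \<chi>_def)

lemma chi_one_left [simp]: "s \<in> S \<Longrightarrow> \<chi> \<one> s = 1"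
  by (simp add: \<chi>_def)

text \<open>These are the coefficients in \<open>(x\<^sub>s x\<^sub>v x\<^sub>s\<^sup>-\<^sup>1)
  x\<^sub>s = x\<^sub>s x\<^sub>v\<close>. The identity presents \<chi>(s,v) as the quotient of
  \<alpha>(s,v) by \<alpha>(s v s^-1, s), the form used in the cocycle computations below.\<close>

lemma chi_mult_cocycle:
  assumes "s \<in> S" "v \<in> S"
  shows "\<chi> s v * \<alpha> (s \<otimes> v \<otimes> inv s) s = \<alpha> s v"
  using cocycle_eq[of "s \<otimes> v" "inv s" s] assms by (simp add: \<chi>_def)

text \<open>Since \<open>x\<^sub>r x\<^sub>s\<close> is a scalar multiple of the basis element for r
  s, both conjugate in the same way and the scalar \<alpha>(r,s) cancels. On the level of \<alpha>
  these are the cocycle identities for (r,s,v), (z,r,s) and (r,w,s), with w and z the successive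
  conjugates of v.\<close>

lemma chi_mult:
  assumes "r \<in> S" "s \<in> S" "v \<in> S"
  shows "\<chi> (r \<otimes> s) v = \<chi> r (s \<otimes> v \<otimes> inv s) * \<chi> s v"
proof -
  define w where "w = s \<otimes> v \<otimes> inv s"
  define z where "z = r \<otimes> w \<otimes> inv r"
  have w: "w \<in> S" "w \<otimes> s = s \<otimes> v" and z: "z \<in> S" "z \<otimes> r = r \<otimes> w"
    using assms by (simp_all add: w_def z_def group_word_simps)
  have z': "r \<otimes> s \<otimes> v \<otimes> inv (r \<otimes> s) = z"
    using assms by (simp add: w_def z_def group_word_simps)
  have quot: "\<chi> s v = \<alpha> s v / \<alpha> w s" "\<chi> r w = \<alpha> r w / \<alpha> z r"
    "\<chi> (r \<otimes> s) v = \<alpha> (r \<otimes> s) v / \<alpha> z (r \<otimes> s)"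
    using chi_mult_cocycle[of s v] chi_mult_cocycle[of r w] chi_mult_cocycle[of "r \<otimes> s" v]
      assms w z z'
    by (simp_all add: eq_divide_eq flip: w_def z_def)
  have e1: "\<alpha> (r \<otimes> s) v = \<alpha> s v * \<alpha> r (s \<otimes> v) / \<alpha> r s"
    using cocycle_eq[of r s v] assms by (simp add: field_simps)
  have e2: "\<alpha> z (r \<otimes> s) = \<alpha> z r * \<alpha> (r \<otimes> w) s / \<alpha> r s"
    using cocycle_eq[of z r s] assms w z by (simp add: field_simps)
  have e3: "\<alpha> r (s \<otimes> v) = \<alpha> r w * \<alpha> (r \<otimes> w) s / \<alpha> w s"
    using cocycle_eq[of r w s] assms w z by (simp add: field_simps)
  show ?thesis
    unfolding w_def[symmetric] quot e1 e2 e3 using assms w z by (simp add: mult.commute)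
qed

text \<open>Here t s t^-1 = s, so \<chi>(t,s) is the ratio of \<alpha>(t,s) to \<alpha>(s,t).
  Non-degeneracy and regularity thereby become statements about the values of \<chi>(t,s) for t
  centralizing s.\<close>

lemma chi_commuting:
  assumes "s \<in> S" "t \<in> S" "t \<otimes> s = s \<otimes> t"
  shows "\<chi> t s = 1 \<longleftrightarrow> \<alpha> s t = \<alpha> t s"
proof -
  have "t \<otimes> s \<otimes> inv t = s"
    using assms by (simp add: group_word_simps)
  then show ?thesis
    using chi_mult_cocycle[of t s] assms
    by (metis cocycle_nonzero mult_cancel_right1)
qed

text \<open>The coefficient of \<open>x\<^sub>v\<^sup>-\<^sup>1 x\<^sub>s x\<^sub>v x\<^sub>s\<^sup>-\<^sup>1\<close>, computed in two ways.\<close>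

lemma chi_commutator:
  assumes "s \<in> S" "v \<in> S"
  shows "\<chi> s v * \<alpha> (inv v) (s \<otimes> v \<otimes> inv s) = \<chi> (inv v) s * \<alpha> (inv v \<otimes> s \<otimes> v) (inv s)"
  using cocycle_eq[of "inv v" s v] cocycle_eq[of "inv v" "s \<otimes> v" "inv s"] assms
  by (simp add: \<chi>_def group_word_simps)


text \<open>Conjugation by \<open>x\<^sub>s\<close> is multiplicative: both sides are the scalar in
  \<open>x\<^sub>s x\<^sub>r x\<^sub>w x\<^sub>s\<^sup>-\<^sup>1\<close>. This makes A closed under
  the pointwise product.\<close>

lemma chi_distrib:
  assumes "s \<in> S" "r \<in> S" "w \<in> S"
  shows "\<chi> s r * \<chi> s w * \<alpha> (s \<otimes> r \<otimes> inv s) (s \<otimes> w \<otimes> inv s) = \<chi> s (r \<otimes> w) * \<alpha> r w"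
proof -
  define r' where "r' = s \<otimes> r \<otimes> inv s"
  define w' where "w' = s \<otimes> w \<otimes> inv s"
  have r': "r' \<in> S" "r' \<otimes> s = s \<otimes> r" and w': "w' \<in> S" "w' \<otimes> s = s \<otimes> w"
    using assms by (simp_all add: r'_def w'_def group_word_simps)
  have rw: "s \<otimes> (r \<otimes> w) \<otimes> inv s = r' \<otimes> w'"
    using assms by (simp add: r'_def w'_def group_word_simps)
  have quot: "\<chi> s r = \<alpha> s r / \<alpha> r' s" "\<chi> s w = \<alpha> s w / \<alpha> w' s"
    "\<chi> s (r \<otimes> w) = \<alpha> s (r \<otimes> w) / \<alpha> (r' \<otimes> w') s"
    using chi_mult_cocycle[of s r] chi_mult_cocycle[of s w] chi_mult_cocycle[of s "r \<otimes> w"]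
      assms r' w' rw
    by (simp_all add: eq_divide_eq flip: r'_def w'_def)
  have e1: "\<alpha> s (r \<otimes> w) = \<alpha> s r * \<alpha> (s \<otimes> r) w / \<alpha> r w"
    using cocycle_eq[of s r w] assms by (simp add: field_simps)
  have e2: "\<alpha> (s \<otimes> r) w = \<alpha> s w * \<alpha> r' (s \<otimes> w) / \<alpha> r' s"
    using cocycle_eq[of r' s w] assms r' by (simp add: field_simps)
  have e3: "\<alpha> r' (s \<otimes> w) = \<alpha> r' w' * \<alpha> (r' \<otimes> w') s / \<alpha> w' s"
    using cocycle_eq[of r' w' s] assms r' w' by (simp add: field_simps)
  show ?thesis
    unfolding r'_def[symmetric] w'_def[symmetric] quot e1 e2 e3 using assms r' w' by (simp add: mult_ac)
qed

section \<open>The Galois object in coefficients\<close>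

text \<open>Substituting u = s v s^-1 in the formula for conjugation turns membership in A into a
  scalar equivariance condition for S acting on G x S by (g,v) -> (s g, s v s^-1).\<close>

lemma galois_object_iff:
  "f \<in> carrier A \<longleftrightarrow> f \<in> carrier G \<rightarrow>\<^sub>E S \<rightarrow>\<^sub>E UNIV \<and>
     (\<forall>s\<in>S. \<forall>g\<in>carrier G. \<forall>v\<in>S. f (s \<otimes> g) (s \<otimes> v \<otimes> inv s) = \<chi> s v * f g v)"
proof -
  have carr: "carrier R = S \<rightarrow>\<^sub>E UNIV"
    by (simp add: twisted_group_algebra_def)
  have "f (s \<otimes> g) = tga_conj G S \<alpha> s (f g) \<longleftrightarrow>
      (\<forall>v\<in>S. f (s \<otimes> g) (s \<otimes> v \<otimes> inv s) = \<chi> s v * f g v)"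
    if f: "f \<in> carrier G \<rightarrow>\<^sub>E S \<rightarrow>\<^sub>E UNIV" and s: "s \<in> S" and g: "g \<in> carrier G" for s g
  proof
    assume "f (s \<otimes> g) = tga_conj G S \<alpha> s (f g)"
    then show "\<forall>v\<in>S. f (s \<otimes> g) (s \<otimes> v \<otimes> inv s) = \<chi> s v * f g v"
      using s by (simp add: tga_conj_apply group_word_simps)
  next
    assume eq: "\<forall>v\<in>S. f (s \<otimes> g) (s \<otimes> v \<otimes> inv s) = \<chi> s v * f g v"
    show "f (s \<otimes> g) = tga_conj G S \<alpha> s (f g)"
    proof (rule tga_carrier_eqI)
      show "f (s \<otimes> g) \<in> carrier R"
        using f s g by (auto simp: carr)
      show "tga_conj G S \<alpha> s (f g) \<in> carrier R"
        by (simp add: tga_conj_def Let_def)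
      fix u assume u: "u \<in> S"
      then show "f (s \<otimes> g) u = tga_conj G S \<alpha> s (f g) u"
        using s eq[rule_format, of "inv s \<otimes> u \<otimes> s"]
        by (simp add: tga_conj_apply group_word_simps)
    qed
  qed
  then show ?thesis
    by (auto simp: galois_object_def Let_def carr)
qed

lemma galois_equivariant:
  assumes "f \<in> carrier A" "s \<in> S" "g \<in> carrier G" "v \<in> S"
  shows "f (s \<otimes> g) (s \<otimes> v \<otimes> inv s) = \<chi> s v * f g v"
  using assms by (simp add: galois_object_iff)

lemma galois_carrierI:
  assumes "\<And>s g v. \<lbrakk>s \<in> S; g \<in> carrier G; v \<in> S\<rbrakk> \<Longrightarrow>
    F (s \<otimes> g) (s \<otimes> v \<otimes> inv s) = \<chi> s v * F g v"
  shows "(\<lambda>g\<in>carrier G. \<lambda>u\<in>S. F g u) \<in> carrier A"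
  using assms by (auto simp: galois_object_iff)

lemma galois_eqI:
  assumes "f \<in> carrier A" "f' \<in> carrier A"
    and "\<And>g u. \<lbrakk>g \<in> carrier G; u \<in> S\<rbrakk> \<Longrightarrow> f g u = f' g u"
  shows "f = f'"
proof (rule PiE_ext)
  show "f \<in> carrier G \<rightarrow>\<^sub>E S \<rightarrow>\<^sub>E UNIV" "f' \<in> carrier G \<rightarrow>\<^sub>E S \<rightarrow>\<^sub>E UNIV"
    using assms by (simp_all add: galois_object_iff)
  then show "f g = f' g" if "g \<in> carrier G" for g
    using assms(3)[OF that] that by (intro PiE_ext[of "f g" S "\<lambda>_. UNIV"]) auto
qed

lemma galois_simps:
  "f \<oplus>\<^bsub>A\<^esub> f' = (\<lambda>g\<in>carrier G. \<lambda>u\<in>S. f g u + f' g u)"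
  "\<zero>\<^bsub>A\<^esub> = (\<lambda>g\<in>carrier G. \<lambda>u\<in>S. 0)"
  "c \<odot>\<^bsub>A\<^esub> f = (\<lambda>g\<in>carrier G. \<lambda>u\<in>S. c * f g u)"
  by (simp_all add: galois_object_def twisted_group_algebra_def)

lemma galois_mult_apply:
  assumes "g \<in> carrier G" "u \<in> S"
  shows "(f \<otimes>\<^bsub>A\<^esub> f') g u = (\<Sum>s\<in>S. f g s * f' g (inv s \<otimes> u) * \<alpha> s (inv s \<otimes> u))"
  using assms tga_mult_apply[of u "f g" "f' g"] by (simp add: galois_object_def Let_def)

lemma galois_add_closed [simp]: "f \<in> carrier A \<Longrightarrow> f' \<in> carrier A \<Longrightarrow> f \<oplus>\<^bsub>A\<^esub> f' \<in> carrier A"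
  unfolding galois_simps by (rule galois_carrierI) (simp add: galois_equivariant algebra_simps)

lemma galois_zero_closed [simp]: "\<zero>\<^bsub>A\<^esub> \<in> carrier A"
  unfolding galois_simps by (rule galois_carrierI) simp

lemma galois_smult_closed [simp]: "f \<in> carrier A \<Longrightarrow> c \<odot>\<^bsub>A\<^esub> f \<in> carrier A"
  unfolding galois_simps by (rule galois_carrierI) (simp add: galois_equivariant algebra_simps)

lemma galois_mult_closed [simp]:
  assumes "f \<in> carrier A" "f' \<in> carrier A"
  shows "f \<otimes>\<^bsub>A\<^esub> f' \<in> carrier A"
proof -
  let ?P = "\<lambda>g u. \<Sum>s\<in>S. f g s * f' g (inv s \<otimes> u) * \<alpha> s (inv s \<otimes> u)"
  have "(\<lambda>g\<in>carrier G. \<lambda>u\<in>S. ?P g u) \<in> carrier A"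
  proof (rule galois_carrierI)
    fix s g v assume sgv: "s \<in> S" "g \<in> carrier G" "v \<in> S"
    have "?P (s \<otimes> g) (s \<otimes> v \<otimes> inv s) = (\<Sum>t\<in>S. \<chi> s v * (f g t * f' g (inv t \<otimes> v) * \<alpha> t (inv t \<otimes> v)))"
    \<comment> \<open>Conjugation by s carries the factorizations of v to those of s v s^-1;
      \<open>chi_distrib\<close> then extracts the common scalar \<chi>(s,v).\<close>
    proof (rule sum.reindex_bij_witness[of _ "\<lambda>t. s \<otimes> t \<otimes> inv s" "\<lambda>t. inv s \<otimes> t \<otimes> s"])
      fix r assume r: "r \<in> S"
      define t where "t = inv s \<otimes> r \<otimes> s"
      have t: "t \<in> S" "r = s \<otimes> t \<otimes> inv s"
        using sgv r by (simp_all add: t_def group_word_simps)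
      have w: "inv r \<otimes> (s \<otimes> v \<otimes> inv s) = s \<otimes> (inv t \<otimes> v) \<otimes> inv s"
        using sgv r by (simp add: t_def group_word_simps)
      have "f (s \<otimes> g) r * f' (s \<otimes> g) (inv r \<otimes> (s \<otimes> v \<otimes> inv s)) * \<alpha> r (inv r \<otimes> (s \<otimes> v \<otimes> inv s))
        = f g t * f' g (inv t \<otimes> v) *
          (\<chi> s t * \<chi> s (inv t \<otimes> v) * \<alpha> (s \<otimes> t \<otimes> inv s) (s \<otimes> (inv t \<otimes> v) \<otimes> inv s))"
        unfolding w using galois_equivariant[OF assms(1), of s g t]
          galois_equivariant[OF assms(2), of s g "inv t \<otimes> v"] t sgv by simp
      also have "\<dots> = f g t * f' g (inv t \<otimes> v) * (\<chi> s v * \<alpha> t (inv t \<otimes> v))"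
        using chi_distrib[of s t "inv t \<otimes> v"] sgv t(1) by simp
      finally show "\<chi> s v * (f g (inv s \<otimes> r \<otimes> s) * f' g (inv (inv s \<otimes> r \<otimes> s) \<otimes> v)
            * \<alpha> (inv s \<otimes> r \<otimes> s) (inv (inv s \<otimes> r \<otimes> s) \<otimes> v))
          = f (s \<otimes> g) r * f' (s \<otimes> g) (inv r \<otimes> (s \<otimes> v \<otimes> inv s)) * \<alpha> r (inv r \<otimes> (s \<otimes> v \<otimes> inv s))"
        unfolding t_def[symmetric] by simp
    qed (use sgv in \<open>auto simp: group_word_simps\<close>)
    then show "?P (s \<otimes> g) (s \<otimes> v \<otimes> inv s) = \<chi> s v * ?P g v"
      by (simp only: sum_distrib_left)
  qed
  also have "(\<lambda>g\<in>carrier G. \<lambda>u\<in>S. ?P g u) = f \<otimes>\<^bsub>A\<^esub> f'"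
  proof (rule PiE_ext)
    show "(\<lambda>g\<in>carrier G. \<lambda>u\<in>S. ?P g u) \<in> carrier G \<rightarrow>\<^sub>E S \<rightarrow>\<^sub>E UNIV"
      "f \<otimes>\<^bsub>A\<^esub> f' \<in> carrier G \<rightarrow>\<^sub>E S \<rightarrow>\<^sub>E UNIV"
      by (auto simp: galois_object_def twisted_group_algebra_def)
    fix g assume g: "g \<in> carrier G"
    show "(\<lambda>g\<in>carrier G. \<lambda>u\<in>S. ?P g u) g = (f \<otimes>\<^bsub>A\<^esub> f') g"
      using g galois_mult_apply[OF g, of _ f f']
      by (intro PiE_ext[of _ S "\<lambda>_. UNIV"]) (auto simp: galois_object_def twisted_group_algebra_def)
  qed
  finally show ?thesis .
qed

lemma translate_closed [simp]:
  assumes "f \<in> carrier A" "g \<in> carrier G"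
  shows "translate G g f \<in> carrier A"
  using assms
  by (auto simp: galois_object_iff translate_def m_assoc dest: bspec[of _ _ "_ \<otimes> g"])

text \<open>Supplies the laws behind the finite sums in A, which occur in the defining identity of
  the Miyashita-Ulbrich action.\<close>

lemma abelian_monoid_galois: "abelian_monoid A"
proof (rule abelian_monoidI)
  fix x y z assume *: "x \<in> carrier A" "y \<in> carrier A" "z \<in> carrier A"
  show "x \<oplus>\<^bsub>A\<^esub> y \<oplus>\<^bsub>A\<^esub> z = x \<oplus>\<^bsub>A\<^esub> (y \<oplus>\<^bsub>A\<^esub> z)"
    by (intro galois_eqI galois_add_closed *) (simp add: galois_simps(1) add.assoc)
next
  fix x assume *: "x \<in> carrier A"
  show "\<zero>\<^bsub>A\<^esub> \<oplus>\<^bsub>A\<^esub> x = x"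
    by (intro galois_eqI galois_add_closed galois_zero_closed *) (simp add: galois_simps)
next
  fix x y assume *: "x \<in> carrier A" "y \<in> carrier A"
  show "x \<oplus>\<^bsub>A\<^esub> y = y \<oplus>\<^bsub>A\<^esub> x"
    by (intro galois_eqI galois_add_closed *) (simp add: galois_simps add.commute)
qed simp_all

lemma galois_finsum_apply:
  assumes "finite I" "\<And>i. i \<in> I \<Longrightarrow> F i \<in> carrier A" "g \<in> carrier G" "u \<in> S"
  shows "(\<Oplus>\<^bsub>A\<^esub>i\<in>I. F i) g u = (\<Sum>i\<in>I. F i g u)"
proof -
  interpret abelian_monoid A by (rule abelian_monoid_galois)
  show ?thesis using assms
  proof (induction I rule: finite_induct)
    case empty
    then show ?case by (simp add: galois_simps)
  next
    case (insert i I)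
    then have "(\<Oplus>\<^bsub>A\<^esub>i\<in>insert i I. F i) = F i \<oplus>\<^bsub>A\<^esub> (\<Oplus>\<^bsub>A\<^esub>i\<in>I. F i)"
      by (intro finsum_insert) auto
    with insert show ?case by (simp add: galois_simps)
  qed
qed

section \<open>Test elements supported on one coset\<close>

text \<open>The element supported on the coset \<open>S k\<close> whose value at \<open>k\<close> is \<open>x\<^sub>v\<close>.\<close>

definition spread :: "'g \<Rightarrow> 'g \<Rightarrow> 'g \<Rightarrow> 'g \<Rightarrow> 'k" where
  "spread k v = (\<lambda>h\<in>carrier G. \<lambda>u\<in>S.
     if h \<otimes> inv k \<in> S \<and> u = (h \<otimes> inv k) \<otimes> v \<otimes> inv (h \<otimes> inv k) then \<chi> (h \<otimes> inv k) v else 0)"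

lemma spread_at:
  assumes "k \<in> carrier G" "s \<in> S" "u \<in> S"
  shows "spread k v (s \<otimes> k) u = (if u = s \<otimes> v \<otimes> inv s then \<chi> s v else 0)"
  using assms by (simp add: spread_def m_assoc)

lemma spread_outside:
  assumes "h \<in> carrier G" "h \<otimes> inv k \<notin> S" "u \<in> S"
  shows "spread k v h u = 0"
  using assms by (simp add: spread_def)

text \<open>Left multiplication by S preserves the coset S k, and on this coset equivariance is the
  rule \<open>chi_mult\<close>.\<close>

lemma spread_closed:
  assumes k: "k \<in> carrier G" and v: "v \<in> S"
  shows "spread k v \<in> carrier A"
  unfolding spread_def
proof (rule galois_carrierI)
  fix s g w assume sgw: "s \<in> S" "g \<in> carrier G" "w \<in> S"
  let ?r = "g \<otimes> inv k"
  have 1: "s \<otimes> g \<otimes> inv k = s \<otimes> ?r"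
    using sgw k by (simp add: m_assoc)
  have 2: "s \<otimes> ?r \<in> S \<longleftrightarrow> ?r \<in> S"
  proof
    assume "s \<otimes> ?r \<in> S"
    from S_closed(1)[OF S_closed(2)[OF sgw(1)] this] show "?r \<in> S"
      using sgw k by simp
  qed (use sgw in simp)
  have 3: "s \<otimes> w \<otimes> inv s = s \<otimes> ?r \<otimes> v \<otimes> inv (s \<otimes> ?r) \<longleftrightarrow> w = ?r \<otimes> v \<otimes> inv ?r"
    if "?r \<in> S"
  proof -
    have "s \<otimes> ?r \<otimes> v \<otimes> inv (s \<otimes> ?r) = s \<otimes> (?r \<otimes> v \<otimes> inv ?r) \<otimes> inv s"
      using sgw k v by (simp add: group_word_simps)
    then show ?thesis
      using sgw k v by simp
  qed
  show "(if s \<otimes> g \<otimes> inv k \<in> S \<and> s \<otimes> w \<otimes> inv s = s \<otimes> g \<otimes> inv k \<otimes> v \<otimes> inv (s \<otimes> g \<otimes> inv k)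
         then \<chi> (s \<otimes> g \<otimes> inv k) v else 0)
      = \<chi> s w * (if ?r \<in> S \<and> w = ?r \<otimes> v \<otimes> inv ?r then \<chi> ?r v else 0)"
    unfolding 1 2 using 3 chi_mult[OF sgw(1) _ v, of ?r] by auto
qed

section \<open>An explicit Miyashita-Ulbrich action\<close>

text \<open>The element g^-1 u g is constant on the S-orbit of (g,u). It is the degree of that
  coefficient in the G-grading of A, so that the idempotent at w acts as the projection to degree w.
  The restrictions provide the extensionality demanded by
  \<open>is_miyashita_ulbrich\<close>.\<close>

definition mu :: "('g \<Rightarrow> 'g \<Rightarrow> 'k) \<Rightarrow> ('g \<Rightarrow> 'k) \<Rightarrow> 'g \<Rightarrow> 'g \<Rightarrow> 'k" where
  "mu = (\<lambda>x\<in>carrier A. \<lambda>p\<in>carrier H. \<lambda>g\<in>carrier G. \<lambda>u\<in>S. x g u * p (inv g \<otimes> u \<otimes> g))"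

lemma mu_apply:
  assumes "x \<in> carrier A" "p \<in> carrier H" "g \<in> carrier G" "u \<in> S"
  shows "mu x p g u = x g u * p (inv g \<otimes> u \<otimes> g)"
  using assms by (simp add: mu_def)

lemma mu_closed:
  assumes "x \<in> carrier A" "p \<in> carrier H"
  shows "mu x p \<in> carrier A"
proof -
  have "(\<lambda>g\<in>carrier G. \<lambda>u\<in>S. x g u * p (inv g \<otimes> u \<otimes> g)) \<in> carrier A"
  proof (rule galois_carrierI)
    fix s g v assume sgv: "s \<in> S" "g \<in> carrier G" "v \<in> S"
    have "inv (s \<otimes> g) \<otimes> (s \<otimes> v \<otimes> inv s) \<otimes> (s \<otimes> g) = inv g \<otimes> v \<otimes> g"
      using sgv by (simp add: group_word_simps)
    then show "x (s \<otimes> g) (s \<otimes> v \<otimes> inv s) * p (inv (s \<otimes> g) \<otimes> (s \<otimes> v \<otimes> inv s) \<otimes> (s \<otimes> g))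
        = \<chi> s v * (x g v * p (inv g \<otimes> v \<otimes> g))"
      using sgv assms by (simp add: galois_equivariant)
  qed
  then show ?thesis
    using assms by (simp add: mu_def)
qed

lemma function_algebra_closed [simp]:
  "p \<in> carrier H \<Longrightarrow> q \<in> carrier H \<Longrightarrow> p \<oplus>\<^bsub>H\<^esub> q \<in> carrier H"
  "p \<in> carrier H \<Longrightarrow> c \<odot>\<^bsub>H\<^esub> p \<in> carrier H"
  "fun_idem G g \<in> carrier H"
  by (auto simp: function_algebra_def fun_idem_def)

lemma function_algebra_apply:
  assumes "g \<in> carrier G"
  shows "(p \<oplus>\<^bsub>H\<^esub> q) g = p g + q g" "(c \<odot>\<^bsub>H\<^esub> p) g = c * p g"
  using assms by (simp_all add: function_algebra_def)

lemma finsum_translate_mult_apply: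
  assumes "y \<in> carrier A" "\<And>g. g \<in> carrier G \<Longrightarrow> D g \<in> carrier A" "h \<in> carrier G" "u \<in> S"
  shows "(\<Oplus>\<^bsub>A\<^esub>g\<in>carrier G. translate G g y \<otimes>\<^bsub>A\<^esub> D g) h u
      = (\<Sum>g\<in>carrier G. \<Sum>s\<in>S. y (h \<otimes> g) s * D g h (inv s \<otimes> u) * \<alpha> s (inv s \<otimes> u))"
proof -
  have "(\<Oplus>\<^bsub>A\<^esub>g\<in>carrier G. translate G g y \<otimes>\<^bsub>A\<^esub> D g) h u
      = (\<Sum>g\<in>carrier G. (translate G g y \<otimes>\<^bsub>A\<^esub> D g) h u)"
    using assms finite_carrier by (intro galois_finsum_apply) auto
  then show ?thesis
    using assms by (simp add: galois_mult_apply translate_def)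
qed

text \<open>At a point h, equivariance of y gives \<open>x\<^sub>t y(h) = (x\<^sub>t y(h)
  x\<^sub>t\<^sup>-\<^sup>1) x\<^sub>t = y(t h) x\<^sub>t\<close>. Moreover t h = h g, where g =
  h^-1 t h is the degree of the coefficient of x at (h,t), so y(t h) is the value of g.y at
  h.\<close>

lemma mu_mult:
  assumes x: "x \<in> carrier A" and y: "y \<in> carrier A"
  shows "x \<otimes>\<^bsub>A\<^esub> y = (\<Oplus>\<^bsub>A\<^esub>g\<in>carrier G. translate G g y \<otimes>\<^bsub>A\<^esub> mu x (fun_idem G g))"
proof (rule galois_eqI)
  interpret A: abelian_monoid A by (rule abelian_monoid_galois)
  have closed: "translate G g y \<otimes>\<^bsub>A\<^esub> mu x (fun_idem G g) \<in> carrier A" if "g \<in> carrier G" for g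
    using that x y by (simp add: mu_closed)
  show "x \<otimes>\<^bsub>A\<^esub> y \<in> carrier A"
    using x y by simp
  show "(\<Oplus>\<^bsub>A\<^esub>g\<in>carrier G. translate G g y \<otimes>\<^bsub>A\<^esub> mu x (fun_idem G g)) \<in> carrier A"
    using closed by (intro A.finsum_closed) auto
  fix h u assume h: "h \<in> carrier G" and u: "u \<in> S"
  have "(\<Oplus>\<^bsub>A\<^esub>g\<in>carrier G. translate G g y \<otimes>\<^bsub>A\<^esub> mu x (fun_idem G g)) h u
      = (\<Sum>g\<in>carrier G. \<Sum>s\<in>S. y (h \<otimes> g) s * mu x (fun_idem G g) h (inv s \<otimes> u) * \<alpha> s (inv s \<otimes> u))"
    using x y h u by (intro finsum_translate_mult_apply mu_closed) auto
  also have "\<dots> = (\<Sum>g\<in>carrier G. \<Sum>s\<in>S. if inv h \<otimes> (inv s \<otimes> u) \<otimes> h = g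
          then y (h \<otimes> g) s * x h (inv s \<otimes> u) * \<alpha> s (inv s \<otimes> u) else 0)"
    using h u x by (intro sum.cong refl) (simp add: mu_apply, simp add: fun_idem_def)
  also have "\<dots> = (\<Sum>s\<in>S. \<Sum>g\<in>carrier G. if inv h \<otimes> (inv s \<otimes> u) \<otimes> h = g
          then y (h \<otimes> g) s * x h (inv s \<otimes> u) * \<alpha> s (inv s \<otimes> u) else 0)"
    by (rule sum.swap)
  \<comment> \<open>Only g = h^-1 (s^-1 u) h survives, and for it h g = s^-1 u h.\<close>
  also have "\<dots> = (\<Sum>s\<in>S. y (inv s \<otimes> u \<otimes> h) s * x h (inv s \<otimes> u) * \<alpha> s (inv s \<otimes> u))"
    using h u finite_carrier by (intro sum.cong) (auto simp: group_word_simps)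
  \<comment> \<open>The factor t = s^-1 u becomes the summation index. The factorizations u = s t
    and u = t (t^-1 u) correspond, since s is the conjugate of t^-1 u by t.\<close>
  also have "\<dots> = (\<Sum>t\<in>S. x h t * y h (inv t \<otimes> u) * \<alpha> t (inv t \<otimes> u))"
  proof (rule sum.reindex_bij_witness[of _ "\<lambda>t. u \<otimes> inv t" "\<lambda>s. inv s \<otimes> u"])
    fix s assume s: "s \<in> S"
    define t where "t = inv s \<otimes> u"
    have t: "t \<in> S" "s = t \<otimes> (inv t \<otimes> u) \<otimes> inv t"
      using s u by (simp_all add: t_def group_word_simps)
    have "y (t \<otimes> h) s * \<alpha> s t = y h (inv t \<otimes> u) * \<alpha> t (inv t \<otimes> u)"
      using galois_equivariant[OF y t(1) h, of "inv t \<otimes> u"]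
        chi_mult_cocycle[of t "inv t \<otimes> u"] t u by (simp flip: t(2))
    then show "x h (inv s \<otimes> u) * y h (inv (inv s \<otimes> u) \<otimes> u) * \<alpha> (inv s \<otimes> u) (inv (inv s \<otimes> u) \<otimes> u)
        = y (inv s \<otimes> u \<otimes> h) s * x h (inv s \<otimes> u) * \<alpha> s (inv s \<otimes> u)"
      unfolding t_def[symmetric] by simp
  qed (use u in \<open>auto simp: group_word_simps\<close>)
  also have "\<dots> = (x \<otimes>\<^bsub>A\<^esub> y) h u"
    using h u by (simp add: galois_mult_apply)
  finally show "(x \<otimes>\<^bsub>A\<^esub> y) h u
      = (\<Oplus>\<^bsub>A\<^esub>g\<in>carrier G. translate G g y \<otimes>\<^bsub>A\<^esub> mu x (fun_idem G g)) h u"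
    by simp
qed

lemma is_miyashita_ulbrich_mu: "is_miyashita_ulbrich G A (translate G) mu"
  unfolding is_miyashita_ulbrich_def Let_def
proof (intro conjI ballI allI)
  show "mu \<in> carrier A \<rightarrow>\<^sub>E carrier H \<rightarrow>\<^sub>E carrier A"
    using mu_closed by (auto simp: mu_def)
  show "mu (x \<oplus>\<^bsub>A\<^esub> y) p = mu x p \<oplus>\<^bsub>A\<^esub> mu y p"
    if "x \<in> carrier A" "y \<in> carrier A" "p \<in> carrier H" for x y p
    using that
    by (intro galois_eqI galois_add_closed mu_closed)
      (simp_all add: mu_apply galois_simps(1)[of "mu x p"], simp add: galois_simps algebra_simps)
  show "mu x (p \<oplus>\<^bsub>H\<^esub> q) = mu x p \<oplus>\<^bsub>A\<^esub> mu x q"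
    if "x \<in> carrier A" "p \<in> carrier H" "q \<in> carrier H" for x p q
    using that
    by (intro galois_eqI galois_add_closed mu_closed function_algebra_closed)
      (simp_all add: mu_apply galois_simps function_algebra_apply algebra_simps)
  show "mu (c \<odot>\<^bsub>A\<^esub> x) p = c \<odot>\<^bsub>A\<^esub> mu x p" if "x \<in> carrier A" "p \<in> carrier H" for c x p
    using that
    by (intro galois_eqI galois_smult_closed mu_closed)
      (simp_all add: mu_apply galois_simps(3)[of c "mu x p"], simp add: galois_simps)
  show "mu x (c \<odot>\<^bsub>H\<^esub> p) = c \<odot>\<^bsub>A\<^esub> mu x p" if "x \<in> carrier A" "p \<in> carrier H" for c x p
    using that
    by (intro galois_eqI galois_smult_closed mu_closed function_algebra_closed)
      (simp_all add: mu_apply galois_simps function_algebra_apply)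
  show "x \<otimes>\<^bsub>A\<^esub> y = (\<Oplus>\<^bsub>A\<^esub>g\<in>carrier G. translate G g y \<otimes>\<^bsub>A\<^esub> mu x (fun_idem G g))"
    if "x \<in> carrier A" "y \<in> carrier A" for x y
    using that by (rule mu_mult)
qed

end

section \<open>Uniqueness of the action from non-degeneracy\<close>

locale nondegenerate_cocycle_on_subgroup = cocycle_on_subgroup +
  assumes nondegenerate: "nondegenerate_cocycle G S \<alpha>"
begin

text \<open>Non-degeneracy yields c in the centralizer of s with \<chi>(c,s) different from 1.
  Replacing v by v c leaves v s v^-1 fixed and multiplies the sum by \<chi>(c,s), so the sum
  vanishes.\<close>

lemma chi_sum_zero:
  assumes s: "s \<in> S" "s \<noteq> \<one>"
  shows "(\<Sum>v\<in>S. \<chi> v s * \<phi> (v \<otimes> s \<otimes> inv v)) = 0"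
proof -
  have "s \<notin> {s \<in> S. \<forall>t \<in> centralizer G S s. \<alpha> s t = \<alpha> t s}"
    using nondegenerate s(2) unfolding nondegenerate_cocycle_def by simp
  with s obtain c where c: "c \<in> S" "c \<otimes> s = s \<otimes> c" "\<alpha> s c \<noteq> \<alpha> c s"
    by (auto simp: centralizer_def)
  have csc: "c \<otimes> s \<otimes> inv c = s"
    using c s by (simp add: group_word_simps)
  have "\<chi> c s \<noteq> 1"
    using chi_commuting[of s c] c s by simp
  have "(\<Sum>v\<in>S. \<chi> v s * \<phi> (v \<otimes> s \<otimes> inv v))
      = (\<Sum>v\<in>S. \<chi> (v \<otimes> c) s * \<phi> (v \<otimes> c \<otimes> s \<otimes> inv (v \<otimes> c)))"
    by (rule sum.reindex_bij_witness[of _ "\<lambda>v. v \<otimes> c" "\<lambda>v. v \<otimes> inv c"])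
      (use c s in \<open>auto simp: m_assoc\<close>)
  also have "\<dots> = (\<Sum>v\<in>S. \<chi> c s * (\<chi> v s * \<phi> (v \<otimes> s \<otimes> inv v)))"
  proof (rule sum.cong)
    fix v assume v: "v \<in> S"
    have "v \<otimes> c \<otimes> s \<otimes> inv (v \<otimes> c) = v \<otimes> (c \<otimes> s \<otimes> inv c) \<otimes> inv v"
      using v c s by (simp add: group_word_simps)
    then show "\<chi> (v \<otimes> c) s * \<phi> (v \<otimes> c \<otimes> s \<otimes> inv (v \<otimes> c))
        = \<chi> c s * (\<chi> v s * \<phi> (v \<otimes> s \<otimes> inv v))"
      using chi_mult[OF v c(1) s(1)] by (simp add: csc)
  qed simp
  also have "\<dots> = \<chi> c s * (\<Sum>v\<in>S. \<chi> v s * \<phi> (v \<otimes> s \<otimes> inv v))"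
    by (simp add: sum_distrib_left)
  finally show ?thesis
    using \<open>\<chi> c s \<noteq> 1\<close> by (simp only: mult_cancel_right1) simp
qed

text \<open>
  Injectivity of the Galois map.  Testing against \<open>spread k v\<close> gives
  \<open>\<Sum>\<^sub>s x\<^sub>s x\<^sub>v x\<^sub>s\<^sup>-\<^sup>1 c\<^sub>s = 0\<close> for all \<open>v\<close>; multiplying by \<open>x\<^sub>v\<^sup>-\<^sup>1\<close> on the left and summing over
  \<open>v\<close> leaves only the term with \<open>s = 1\<close>, by non-degeneracy.
\<close>

lemma galois_map_injective:
  fixes d :: "'a \<Rightarrow> 'a \<Rightarrow> 'a \<Rightarrow> 'c"
  assumes zero: "\<And>y h u. \<lbrakk>y \<in> carrier A; h \<in> carrier G; u \<in> S\<rbrakk> \<Longrightarrow>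
      (\<Sum>g\<in>carrier G. \<Sum>s\<in>S. y (h \<otimes> g) s * d g h (inv s \<otimes> u) * \<alpha> s (inv s \<otimes> u)) = 0"
    and g: "g \<in> carrier G" and h: "h \<in> carrier G" and u: "u \<in> S"
  shows "d g h u = 0"
proof -
  define k where "k = h \<otimes> g"
  \<comment> \<open>The element h^-1 s k is the one that carries h to s k by right multiplication;
    \<open>D s\<close> is the coefficient \<open>c\<^sub>s\<close> of the description above.\<close>
  define D where "D s = d (inv h \<otimes> s \<otimes> k) h" for s
  have k: "k \<in> carrier G"
    using g h by (simp add: k_def)
  \<comment> \<open>This is the hypothesis for \<open>y = spread k v\<close>: g contributes only if
    h g lies in S k, and then a single coefficient of the test element is nonzero.\<close>
  have coset: "(\<Sum>s\<in>S. \<chi> s v * D s (inv (s \<otimes> v \<otimes> inv s) \<otimes> w)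
        * \<alpha> (s \<otimes> v \<otimes> inv s) (inv (s \<otimes> v \<otimes> inv s) \<otimes> w)) = 0"
    if v: "v \<in> S" and w: "w \<in> S" for v w
  proof -
    define T where "T g = (\<Sum>s\<in>S. spread k v (h \<otimes> g) s * d g h (inv s \<otimes> w) * \<alpha> s (inv s \<otimes> w))" for g
    let ?f = "\<lambda>s. inv h \<otimes> s \<otimes> k"
    have "0 = sum T (carrier G)"
      using zero[OF spread_closed[OF k v] h w] by (simp add: T_def)
    also have "sum T (carrier G) = sum T (?f ` S)"
    proof (rule sum.mono_neutral_right)
      show "\<forall>g\<in>carrier G - ?f ` S. T g = 0"
      proof
        fix g assume g: "g \<in> carrier G - ?f ` S"
        have "h \<otimes> g \<otimes> inv k \<notin> S"
        proof
          assume "h \<otimes> g \<otimes> inv k \<in> S"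
          moreover have "?f (h \<otimes> g \<otimes> inv k) = g"
            using g h k by (simp add: m_assoc)
          ultimately show False
            using g by force
        qed
        then show "T g = 0"
          using g h by (simp add: T_def spread_outside)
      qed
    qed (use finite_carrier h k in auto)
    also have "\<dots> = (\<Sum>s\<in>S. T (?f s))"
      by (intro sum.reindex[unfolded o_def] inj_onI) (use h k in simp)
    also have "\<dots> = (\<Sum>s\<in>S. \<chi> s v * D s (inv (s \<otimes> v \<otimes> inv s) \<otimes> w)
        * \<alpha> (s \<otimes> v \<otimes> inv s) (inv (s \<otimes> v \<otimes> inv s) \<otimes> w))"
    proof (rule sum.cong)
      fix s assume s: "s \<in> S"
      let ?c = "s \<otimes> v \<otimes> inv s"
      have "h \<otimes> ?f s = s \<otimes> k"
        using s h k by (simp add: m_assoc)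
      then have "T (?f s) = (\<Sum>r\<in>S. if r = ?c
          then \<chi> s v * D s (inv ?c \<otimes> w) * \<alpha> ?c (inv ?c \<otimes> w) else 0)"
        unfolding T_def D_def[symmetric] using s k by (intro sum.cong) (auto simp: spread_at)
      then show "T (?f s) = \<chi> s v * D s (inv ?c \<otimes> w) * \<alpha> ?c (inv ?c \<otimes> w)"
        using s v by simp
    qed simp
    finally show ?thesis
      by simp
  qed
  \<comment> \<open>What remains of the (s,v) term after \<open>chi_commutator\<close>, as a
    function of w = v^-1 s v alone. This gives the sum over v the shape required by
    \<open>chi_sum_zero\<close>.\<close>
  define \<phi> where "\<phi> s w = \<alpha> w (inv s) * D s (inv (w \<otimes> inv s) \<otimes> u)
      * \<alpha> (w \<otimes> inv s) (inv (w \<otimes> inv s) \<otimes> u)" for s w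
  \<comment> \<open>The factor \<alpha>(v^-1, v u) comes from left multiplication by
    \<open>x\<^sub>v\<^sup>-\<^sup>1\<close>, read off at u.\<close>
  have "0 = (\<Sum>v\<in>S. \<alpha> (inv v) (v \<otimes> u) * (\<Sum>s\<in>S. \<chi> s v * D s (inv (s \<otimes> v \<otimes> inv s) \<otimes> (v \<otimes> u))
        * \<alpha> (s \<otimes> v \<otimes> inv s) (inv (s \<otimes> v \<otimes> inv s) \<otimes> (v \<otimes> u))))"
    using coset u by simp
  also have "\<dots> = (\<Sum>v\<in>S. \<Sum>s\<in>S. \<chi> (inv v) s * \<phi> s (inv v \<otimes> s \<otimes> v))"
    unfolding sum_distrib_left
  proof (intro sum.cong refl)
    fix v s assume v: "v \<in> S" and s: "s \<in> S"
    define c where "c = s \<otimes> v \<otimes> inv s"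
    define t where "t = inv c \<otimes> (v \<otimes> u)"
    define q where "q = inv v \<otimes> s \<otimes> v \<otimes> inv s"
    have c: "c \<in> S" "c \<otimes> t = v \<otimes> u" and t: "t \<in> S" "inv q \<otimes> u = t" and q: "inv v \<otimes> c = q"
      using v s u by (simp_all add: c_def t_def q_def group_word_simps)
    have "\<alpha> (inv v) (v \<otimes> u) * (\<chi> s v * D s t * \<alpha> c t)
        = \<chi> s v * D s t * (\<alpha> c t * \<alpha> (inv v) (c \<otimes> t))"
      using c by simp
    also have "\<dots> = D s t * (\<chi> s v * \<alpha> (inv v) c) * \<alpha> q t"
      using cocycle_eq[of "inv v" c t] v c t q by (simp add: mult_ac)
    also have "\<dots> = \<chi> (inv v) s * \<phi> s (inv v \<otimes> s \<otimes> v)"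
      unfolding c_def chi_commutator[OF s v] \<phi>_def q_def[symmetric] t(2) by simp
    finally show "\<alpha> (inv v) (v \<otimes> u) * (\<chi> s v * D s (inv (s \<otimes> v \<otimes> inv s) \<otimes> (v \<otimes> u))
        * \<alpha> (s \<otimes> v \<otimes> inv s) (inv (s \<otimes> v \<otimes> inv s) \<otimes> (v \<otimes> u)))
        = \<chi> (inv v) s * \<phi> s (inv v \<otimes> s \<otimes> v)"
      unfolding t_def c_def .
  qed
  also have "\<dots> = (\<Sum>s\<in>S. \<Sum>v\<in>S. \<chi> (inv v) s * \<phi> s (inv v \<otimes> s \<otimes> v))"
    by (rule sum.swap)
  \<comment> \<open>For s = 1 every v contributes the same value d g h u, because h^-1 k = g; every
    other s gives zero by non-degeneracy.\<close>
  also have "\<dots> = (\<Sum>s\<in>S. if s = \<one> then of_nat (card S) * d g h u else 0)"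
  proof (rule sum.cong)
    fix s assume s: "s \<in> S"
    have "(\<Sum>v\<in>S. \<chi> (inv v) s * \<phi> s (inv v \<otimes> s \<otimes> v)) = (\<Sum>v\<in>S. \<chi> v s * \<phi> s (v \<otimes> s \<otimes> inv v))"
      by (rule sum.reindex_bij_witness[of _ "\<lambda>v. inv v" "\<lambda>v. inv v"]) auto
    also have "\<dots> = (if s = \<one> then of_nat (card S) * d g h u else 0)"
    proof (cases "s = \<one>")
      case True
      have "\<phi> \<one> \<one> = d g h u"
        using g h k u by (simp add: \<phi>_def D_def k_def)
      then show ?thesis
        using True by simp
    qed (use s in \<open>simp add: chi_sum_zero\<close>)
    finally show "(\<Sum>v\<in>S. \<chi> (inv v) s * \<phi> s (inv v \<otimes> s \<otimes> v))
        = (if s = \<one> then of_nat (card S) * d g h u else 0)" .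
  qed simp
  finally have "of_nat (card S) * d g h u = 0"
    by simp
  \<comment> \<open>In characteristic zero a nonzero cardinality can be cancelled in the
    field.\<close>
  moreover have "card S \<noteq> 0"
    using S_closed(3) by (metis card_0_eq empty_iff finite_S)
  ultimately show ?thesis
    by simp
qed

text \<open>Both maps give the same expansion of x y for every y, so their difference on the
  idempotents lies in the kernel of the Galois map, which is zero.\<close>

lemma miyashita_ulbrich_fun_idem:
  assumes \<mu>: "is_miyashita_ulbrich G A (translate G) \<mu>"
    and x: "x \<in> carrier A" and g: "g \<in> carrier G"
  shows "\<mu> x (fun_idem G g) = mu x (fun_idem G g)"
proof -
  have closed: "\<mu> x (fun_idem G g) \<in> carrier A" for g
    using \<mu> x unfolding is_miyashita_ulbrich_def Let_def by (auto dest!: PiE_mem)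
  have mult: "x \<otimes>\<^bsub>A\<^esub> y = (\<Oplus>\<^bsub>A\<^esub>g\<in>carrier G. translate G g y \<otimes>\<^bsub>A\<^esub> \<mu> x (fun_idem G g))"
    if "y \<in> carrier A" for y
    using \<mu> x that unfolding is_miyashita_ulbrich_def Let_def by blast
  show ?thesis
  proof (rule galois_eqI)
    fix h u assume hu: "h \<in> carrier G" "u \<in> S"
    have "\<mu> x (fun_idem G g) h u - mu x (fun_idem G g) h u = 0"
    proof (rule galois_map_injective[of "\<lambda>g h u. \<mu> x (fun_idem G g) h u - mu x (fun_idem G g) h u"])
      fix y h u assume *: "y \<in> carrier A" "h \<in> carrier G" "u \<in> S"
      have "(x \<otimes>\<^bsub>A\<^esub> y) h u = (\<Sum>g\<in>carrier G. \<Sum>s\<in>S. y (h \<otimes> g) s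
          * \<mu> x (fun_idem G g) h (inv s \<otimes> u) * \<alpha> s (inv s \<otimes> u))"
        unfolding mult[OF *(1)] using * closed by (intro finsum_translate_mult_apply)
      moreover have "(x \<otimes>\<^bsub>A\<^esub> y) h u = (\<Sum>g\<in>carrier G. \<Sum>s\<in>S. y (h \<otimes> g) s
          * mu x (fun_idem G g) h (inv s \<otimes> u) * \<alpha> s (inv s \<otimes> u))"
        unfolding mu_mult[OF x *(1)] using * x
        by (intro finsum_translate_mult_apply mu_closed) auto
      ultimately show "(\<Sum>g\<in>carrier G. \<Sum>s\<in>S. y (h \<otimes> g) s
          * (\<mu> x (fun_idem G g) h (inv s \<otimes> u) - mu x (fun_idem G g) h (inv s \<otimes> u))
          * \<alpha> s (inv s \<otimes> u)) = 0"
        by (simp add: right_diff_distrib left_diff_distrib sum_subtractf)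
    qed (use hu g in auto)
    then show "\<mu> x (fun_idem G g) h u = mu x (fun_idem G g) h u"
      by simp
  qed (use x closed in \<open>auto intro: mu_closed\<close>)
qed

text \<open>The idempotents span the function algebra, so linearity reduces the claim to them. The
  induction runs over a finite set T outside of which p vanishes.\<close>

lemma miyashita_ulbrich_unique:
  assumes \<mu>: "is_miyashita_ulbrich G A (translate G) \<mu>"
  shows "\<mu> = mu"
proof -
  have linear: "\<nu> x (p \<oplus>\<^bsub>H\<^esub> q) = \<nu> x p \<oplus>\<^bsub>A\<^esub> \<nu> x q" "\<nu> x (c \<odot>\<^bsub>H\<^esub> p) = c \<odot>\<^bsub>A\<^esub> \<nu> x p"
    if "is_miyashita_ulbrich G A (translate G) \<nu>" "x \<in> carrier A" "p \<in> carrier H" "q \<in> carrier H"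
    for \<nu> x p q c
    using that unfolding is_miyashita_ulbrich_def Let_def by blast+
  have eq: "\<mu> x p = mu x p"
    if x: "x \<in> carrier A" and "finite T" "p \<in> carrier H" "\<forall>g \<in> carrier G - T. p g = 0"
      "T \<subseteq> carrier G" for x p T
    using that(2-)
  proof (induction T arbitrary: p rule: finite_induct)
    case empty
    \<comment> \<open>Writing the zero function as 0 times itself yields its image from homogeneity
      alone.\<close>
    have p0: "0 \<odot>\<^bsub>H\<^esub> p = p"
      using empty by (auto simp: function_algebra_def fun_eq_iff PiE_def extensional_def)
    have zero: "0 \<odot>\<^bsub>A\<^esub> a = \<zero>\<^bsub>A\<^esub>" for a
      by (simp add: galois_simps)
    have "\<nu> x p = \<zero>\<^bsub>A\<^esub>" if "is_miyashita_ulbrich G A (translate G) \<nu>" for \<nu>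
      using linear(2)[OF that x empty(1) empty(1), of 0] unfolding p0 zero .
    from this[OF \<mu>] this[OF is_miyashita_ulbrich_mu] show ?case
      by simp
  next
    case (insert t T)
    \<comment> \<open>Splits off the coordinate at t: p is q plus p(t) times the idempotent at t,
      and q vanishes outside the smaller set.\<close>
    define q where "q = (\<lambda>g\<in>carrier G. if g = t then 0 else p g)"
    have q: "q \<in> carrier H"
      by (simp add: q_def function_algebra_def)
    have pdec: "q \<oplus>\<^bsub>H\<^esub> (p t \<odot>\<^bsub>H\<^esub> fun_idem G t) = p"
      using insert.prems(1)
      by (auto simp: function_algebra_def q_def fun_idem_def fun_eq_iff PiE_def extensional_def)
    have dec: "\<nu> x p = \<nu> x q \<oplus>\<^bsub>A\<^esub> (p t \<odot>\<^bsub>A\<^esub> \<nu> x (fun_idem G t))"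
      if "is_miyashita_ulbrich G A (translate G) \<nu>" for \<nu>
      using linear(1)[OF that x q function_algebra_closed(2)[OF function_algebra_closed(3)], of "p t" t]
      unfolding linear(2)[OF that x function_algebra_closed(3) q] pdec .
    have "\<mu> x q = mu x q"
      by (rule insert.IH[OF q]) (use insert.prems in \<open>auto simp: q_def\<close>)
    then show ?case
      using dec[OF \<mu>] dec[OF is_miyashita_ulbrich_mu]
        miyashita_ulbrich_fun_idem[OF \<mu> x, of t] insert.prems by simp
  qed
  have PiE: "\<nu> \<in> carrier A \<rightarrow>\<^sub>E carrier H \<rightarrow>\<^sub>E carrier A"
    if "is_miyashita_ulbrich G A (translate G) \<nu>" for \<nu>
    using that unfolding is_miyashita_ulbrich_def Let_def by blast
  show ?thesis
  proof (rule PiE_ext[OF PiE[OF \<mu>] PiE[OF is_miyashita_ulbrich_mu]])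
    fix x assume x: "x \<in> carrier A"
    show "\<mu> x = mu x"
      by (rule PiE_ext[OF PiE_mem[OF PiE[OF \<mu>] x] PiE_mem[OF PiE[OF is_miyashita_ulbrich_mu] x]])
        (use eq[OF x finite_carrier] in auto)
  qed
qed

lemma miyashita_ulbrich_eq: "miyashita_ulbrich G A (translate G) = mu"
  unfolding miyashita_ulbrich_def
  using is_miyashita_ulbrich_mu miyashita_ulbrich_unique by (rule the_equality)

section \<open>Invariants and the submodule condition\<close>

context
  fixes F :: "'a set"
  assumes subgroup_F: "subgroup F G"
begin

lemma F_carrier [simp]: "f \<in> F \<Longrightarrow> f \<in> carrier G"
  using subgroup_F subgroup.subset by blast

lemma F_closed:
  "f \<in> F \<Longrightarrow> f' \<in> F \<Longrightarrow> f \<otimes> f' \<in> F" "f \<in> F \<Longrightarrow> inv f \<in> F" "\<one> \<in> F"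
  using subgroup_F by (auto intro: subgroup.m_closed subgroup.m_inv_closed subgroup.one_closed)

abbreviation Inv where "Inv \<equiv> invariants A (translate G) F"

lemma invariants_iff:
  "x \<in> Inv \<longleftrightarrow> x \<in> carrier A \<and> (\<forall>f\<in>F. \<forall>h\<in>carrier G. \<forall>u\<in>S. x (h \<otimes> f) u = x h u)"
proof -
  have "translate G f x = x \<longleftrightarrow> (\<forall>h\<in>carrier G. \<forall>u\<in>S. x (h \<otimes> f) u = x h u)"
    if x: "x \<in> carrier A" and f: "f \<in> F" for f
  proof
    assume "translate G f x = x"
    then have "translate G f x h u = x h u" for h u
      by simp
    then show "\<forall>h\<in>carrier G. \<forall>u\<in>S. x (h \<otimes> f) u = x h u"
      unfolding translate_def by (metis restrict_apply')
  next
    assume "\<forall>h\<in>carrier G. \<forall>u\<in>S. x (h \<otimes> f) u = x h u"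
    then show "translate G f x = x"
      using x f by (intro galois_eqI) (simp_all, simp add: translate_def)
  qed
  then show ?thesis
    by (auto simp: invariants_def)
qed

lemma subgroup_invariants: "subgroup Inv (add_monoid (miyashita_ulbrich_module G A (translate G)))"
proof
  show "Inv \<subseteq> carrier (add_monoid (miyashita_ulbrich_module G A (translate G)))"
    by (auto simp: invariants_iff miyashita_ulbrich_module_def)
  show "x \<otimes>\<^bsub>add_monoid (miyashita_ulbrich_module G A (translate G))\<^esub> y \<in> Inv"
    if "x \<in> Inv" "y \<in> Inv" for x y
    using that by (simp add: invariants_iff miyashita_ulbrich_module_def) (simp add: galois_simps)
  show "\<one>\<^bsub>add_monoid (miyashita_ulbrich_module G A (translate G))\<^esub> \<in> Inv"
    by (simp add: invariants_iff miyashita_ulbrich_module_def) (simp add: galois_simps)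
  show "inv\<^bsub>add_monoid (miyashita_ulbrich_module G A (translate G))\<^esub> x \<in> Inv" if x: "x \<in> Inv" for x
  proof -
    \<comment> \<open>The additive inverse is again a definite description; both inverse laws and
      uniqueness identify it with the multiple by -1.\<close>
    let ?y = "(-1) \<odot>\<^bsub>A\<^esub> x"
    have xA: "x \<in> carrier A"
      using x by (simp add: invariants_iff)
    have 1: "x \<oplus>\<^bsub>A\<^esub> ?y = \<zero>\<^bsub>A\<^esub>" "?y \<oplus>\<^bsub>A\<^esub> x = \<zero>\<^bsub>A\<^esub>"
      by (simp_all add: galois_simps cong: restrict_cong)
    have 2: "y = ?y" if y: "y \<in> carrier A" "x \<oplus>\<^bsub>A\<^esub> y = \<zero>\<^bsub>A\<^esub>" for y
    proof (rule galois_eqI)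
      fix g u assume gu: "g \<in> carrier G" "u \<in> S"
      have "(x \<oplus>\<^bsub>A\<^esub> y) g u = \<zero>\<^bsub>A\<^esub> g u"
        using y by simp
      then show "y g u = ?y g u"
        using gu by (simp add: galois_simps add_eq_0_iff)
    qed (use xA y in simp_all)
    have "inv\<^bsub>add_monoid (miyashita_ulbrich_module G A (translate G))\<^esub> x = ?y"
      unfolding m_inv_def[of "add_monoid (miyashita_ulbrich_module G A (translate G))"]
      by (rule the_equality) (use 1 2 xA in \<open>auto simp: miyashita_ulbrich_module_def\<close>)
    moreover have "?y \<in> Inv"
      using x by (simp add: invariants_iff) (simp add: galois_simps)
    ultimately show ?thesis
      by simp
  qed
qed

text \<open>Put w = g^-1 u g. Passing from (g,u) to (g f,u) keeps the coefficient of an invariant x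
  but changes the factor p(w) into p(f^-1 w f). These agree for all p exactly when f fixes w under
  conjugation.\<close>

lemma submodule_invariants_iff:
  "submodule Inv H (miyashita_ulbrich_module G A (translate G)) \<longleftrightarrow>
    (\<forall>x\<in>Inv. \<forall>g\<in>carrier G. \<forall>u\<in>S. x g u \<noteq> 0 \<longrightarrow>
      (\<forall>f\<in>F. inv f \<otimes> (inv g \<otimes> u \<otimes> g) \<otimes> f = inv g \<otimes> u \<otimes> g))"
    (is "?L \<longleftrightarrow> ?R")
proof -
  have word: "inv (g \<otimes> f) \<otimes> u \<otimes> (g \<otimes> f) = inv f \<otimes> (inv g \<otimes> u \<otimes> g) \<otimes> f"
    if "g \<in> carrier G" "u \<in> S" "f \<in> F" for g u f
    using that by (simp add: group_word_simps)
  have "?L \<longleftrightarrow> (\<forall>p\<in>carrier H. \<forall>x\<in>Inv. mu x p \<in> Inv)"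
    using subgroup_invariants
    by (auto simp: submodule_def submodule_axioms_def miyashita_ulbrich_eq
        miyashita_ulbrich_module_def)
  also have "\<dots> \<longleftrightarrow> ?R"
  proof (intro iffI ballI impI)
    fix x g u f
    assume closed: "\<forall>p\<in>carrier H. \<forall>x\<in>Inv. mu x p \<in> Inv"
      and x: "x \<in> Inv" and gu: "g \<in> carrier G" "u \<in> S" and nz: "x g u \<noteq> 0" and f: "f \<in> F"
    let ?w = "inv g \<otimes> u \<otimes> g"
    \<comment> \<open>The idempotent at w separates w from every other element.\<close>
    let ?p = "fun_idem G ?w :: 'a \<Rightarrow> 'c"
    have "mu x ?p (g \<otimes> f) u = mu x ?p g u"
      using closed x f gu by (simp add: invariants_iff)
    moreover have "x (g \<otimes> f) u = x g u"
      using x f gu by (simp add: invariants_iff)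
    ultimately have "x g u * ?p (inv f \<otimes> ?w \<otimes> f) = x g u * ?p ?w"
      using x f gu by (simp add: mu_apply invariants_iff word)
    then have "?p (inv f \<otimes> ?w \<otimes> f) = ?p ?w"
      using nz by simp
    then show "inv f \<otimes> ?w \<otimes> f = ?w"
      using gu f by (simp add: fun_idem_def split: if_splits)
  next
    fix p x assume R: ?R and p: "p \<in> carrier H" and x: "x \<in> Inv"
    show "mu x p \<in> Inv"
      unfolding invariants_iff
    proof (intro conjI ballI)
      show "mu x p \<in> carrier A"
        using x p by (simp add: invariants_iff mu_closed)
      fix f h u assume *: "f \<in> F" "h \<in> carrier G" "u \<in> S"
      have "x (h \<otimes> f) u = x h u"
        using x * by (simp add: invariants_iff)
      moreover have "x h u = 0 \<or> inv f \<otimes> (inv h \<otimes> u \<otimes> h) \<otimes> f = inv h \<otimes> u \<otimes> h"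
        using R x * by blast
      ultimately show "mu x p (h \<otimes> f) u = mu x p h u"
        using x p * by (auto simp: mu_apply invariants_iff word)
    qed
  qed
  finally show ?thesis .
qed

section \<open>Regularity and the supports of invariants\<close>

text \<open>Such a t equals g f g^-1 with f in F and commutes with u, so (t g, t u t^-1) = (g f, u).
  There x takes the value \<chi>(t,u) x(g,u) by equivariance and x(g,u) by invariance, so
  \<chi>(t,u) = 1.\<close>

lemma invariant_support_regular:
  assumes x: "x \<in> Inv" and g: "g \<in> carrier G" and u: "u \<in> S" and nz: "x g u \<noteq> 0"
    and t: "t \<in> centralizer G S u \<inter> conj_subgroup G F (inv g)"
  shows "\<alpha> u t = \<alpha> t u"
proof -
  obtain f where f: "f \<in> F" "t = g \<otimes> f \<otimes> inv g"
    using t g by (auto simp: conj_subgroup_def)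
  have tS: "t \<in> S" "t \<otimes> u = u \<otimes> t"
    using t by (auto simp: centralizer_def)
  have tg: "t \<otimes> g = g \<otimes> f"
    using f g by (simp add: m_assoc)
  have tu: "t \<otimes> u \<otimes> inv t = u"
    using tS u by (simp add: group_word_simps)
  have "x (t \<otimes> g) (t \<otimes> u \<otimes> inv t) = \<chi> t u * x g u"
    using x tS g u by (intro galois_equivariant) (simp_all add: invariants_iff)
  moreover have "x (g \<otimes> f) u = x g u"
    using x f g u by (simp add: invariants_iff)
  ultimately have "\<chi> t u = 1"
    using nz by (simp add: tg tu)
  then show ?thesis
    using chi_commuting[of u t] tS u by simp
qed

text \<open>The witness is \<open>spread k v\<close> summed over its F-translates. At (k,v)
  regularity prevents cancellation: every nonzero summand is 1, so the value is the order of a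
  stabilizer, nonzero in characteristic zero.\<close>

lemma regular_imp_invariant_support:
  assumes k: "k \<in> carrier G" and v: "v \<in> S"
    and regular: "\<forall>t \<in> centralizer G S v \<inter> conj_subgroup G F (inv k). \<alpha> v t = \<alpha> t v"
  shows "\<exists>x\<in>Inv. x k v \<noteq> 0"
proof
  have finF: "finite F"
    using finite_carrier subgroup_F finite_subset subgroup.subset by blast
  define x where "x = (\<lambda>h\<in>carrier G. \<lambda>u\<in>S. \<Sum>f\<in>F. spread k v (h \<otimes> f) u)"
  have "x \<in> carrier A"
    unfolding x_def
  proof (rule galois_carrierI)
    fix s g w assume *: "s \<in> S" "g \<in> carrier G" "w \<in> S"
    then show "(\<Sum>f\<in>F. spread k v (s \<otimes> g \<otimes> f) (s \<otimes> w \<otimes> inv s)) = \<chi> s w * (\<Sum>f\<in>F. spread k v (g \<otimes> f) w)"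
      using galois_equivariant[OF spread_closed[OF k v]]
      by (simp add: m_assoc[of s g] sum_distrib_left)
  qed
  moreover have "x (h \<otimes> f) u = x h u" if "f \<in> F" "h \<in> carrier G" "u \<in> S" for f h u
  proof -
    have "(\<Sum>f'\<in>F. spread k v (h \<otimes> f \<otimes> f') u) = (\<Sum>f'\<in>F. spread k v (h \<otimes> f') u)"
      by (rule sum.reindex_bij_witness[of _ "\<lambda>f'. inv f \<otimes> f'" "\<lambda>f'. f \<otimes> f'"])
        (use that F_closed in \<open>auto simp: m_assoc\<close>)
    then show ?thesis
      using that by (simp add: x_def)
  qed
  ultimately show "x \<in> Inv"
    by (simp add: invariants_iff)
  \<comment> \<open>The f in F for which t = k f k^-1 lies in S and carries (k,v) to (k f, v); the
    other translates vanish at (k,v).\<close>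
  let ?stab = "{f \<in> F. k \<otimes> f \<otimes> inv k \<in> S \<and> v = k \<otimes> f \<otimes> inv k \<otimes> v \<otimes> inv (k \<otimes> f \<otimes> inv k)}"
  have "x k v = (\<Sum>f\<in>F. if f \<in> ?stab then 1 else 0)"
  proof -
    have "spread k v (k \<otimes> f) v = (if f \<in> ?stab then 1 else 0)" if f: "f \<in> F" for f
    proof -
      define t where "t = k \<otimes> f \<otimes> inv k"
      have "\<chi> t v = 1" if t: "t \<in> S" "v = t \<otimes> v \<otimes> inv t"
      proof -
        have comm: "t \<otimes> v = v \<otimes> t"
          using t v by (metis S_carrier S_closed(1) inv_solve_right')
        have "t \<in> conj_subgroup G F (inv k)"
          using f k by (auto simp: conj_subgroup_def t_def)
        then show ?thesis
          using regular t(1) comm v chi_commuting by (auto simp: centralizer_def)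
      qed
      then show ?thesis
        using f k v by (auto simp: spread_def simp flip: t_def)
    qed
    then show ?thesis
      using k v by (simp add: x_def)
  qed
  also have "\<dots> = of_nat (card ?stab)"
    using finF by (simp flip: sum.inter_filter)
  also have "\<dots> \<noteq> 0"
  proof -
    have "\<one> \<in> ?stab"
      using k v F_closed(3) by simp
    then show ?thesis
      using finF by (auto simp: card_eq_0_iff)
  qed
  finally show "x k v \<noteq> 0" .
qed

section \<open>Passage to classes in the balanced product\<close>

lemma balanced_productE:
  assumes "C \<in> balanced_product G S" "(g, s) \<in> C"
  shows "g \<in> carrier G" "s \<in> S"
  using assms by (auto simp: balanced_product_def balanced_rel_def quotient_def)

theorem invariants_submodule_iff:
  "submodule Inv H (miyashita_ulbrich_module G A (translate G)) \<longleftrightarrow>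
    (\<forall>C \<in> balanced_product G S. regular_class G S \<alpha> F C \<longrightarrow>
      (\<forall>(g, s) \<in> C. conj_subgroup G F g \<subseteq> centralizer G (carrier G) s))"
    (is "?L \<longleftrightarrow> ?R")
proof
  assume L: ?L
  show ?R
  proof (clarify)
    fix C g s y
    assume C: "C \<in> balanced_product G S" "regular_class G S \<alpha> F C" "(g, s) \<in> C"
      and y: "y \<in> conj_subgroup G F g"
    have g: "g \<in> carrier G" and s: "s \<in> S"
      using balanced_productE C by auto
    obtain f where f: "f \<in> F" "y = inv g \<otimes> f \<otimes> g"
      using y by (auto simp: conj_subgroup_def)
    \<comment> \<open>The class of (g,s) corresponds to the S-orbit of the point (g^-1, s), whence
      the inverse.\<close>
    have "\<exists>x\<in>Inv. x (inv g) s \<noteq> 0"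
      using C g s by (intro regular_imp_invariant_support) (auto simp: regular_class_def)
    then have "inv f \<otimes> (g \<otimes> s \<otimes> inv g) \<otimes> f = g \<otimes> s \<otimes> inv g"
      using L g s f unfolding submodule_invariants_iff by (metis inv_closed inv_inv)
    \<comment> \<open>Thus f commutes with g s g^-1, and conjugating back by g shows that y = g^-1 f
      g commutes with s.\<close>
    then have "f \<otimes> (inv f \<otimes> (g \<otimes> s \<otimes> inv g) \<otimes> f) = f \<otimes> (g \<otimes> s \<otimes> inv g)"
      by simp
    then have "inv g \<otimes> ((g \<otimes> s \<otimes> inv g) \<otimes> f) \<otimes> g = inv g \<otimes> (f \<otimes> (g \<otimes> s \<otimes> inv g)) \<otimes> g"
      using f g s by (simp add: m_assoc)
    then have "s \<otimes> y = y \<otimes> s"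
      using f g s by (simp add: m_assoc)
    then show "y \<in> centralizer G (carrier G) s"
      using f g by (simp add: centralizer_def)
  qed
next
  assume R: ?R
  show ?L
    unfolding submodule_invariants_iff
  proof (intro ballI impI)
    fix x g u f
    assume x: "x \<in> Inv" and g: "g \<in> carrier G" and u: "u \<in> S" and nz: "x g u \<noteq> 0" and f: "f \<in> F"
    define C where "C = balanced_rel G S `` {(inv g, u)}"
    have C: "C \<in> balanced_product G S"
      using g u by (auto simp: C_def balanced_product_def quotient_def)
    \<comment> \<open>The choice t = 1 in the relation shows that C contains the pair defining
      it.\<close>
    have "(inv g \<otimes> inv \<one>, \<one> \<otimes> u \<otimes> inv \<one>) \<in> C"
      using g u S_closed(3) unfolding C_def balanced_rel_def by blast
    then have mem: "(inv g, u) \<in> C"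
      using g u by simp
    \<comment> \<open>Every member of C is ((t g)^-1, t u t^-1) for some t in S. As \<chi>(t,u) is
      nonzero, x does not vanish at (t g, t u t^-1), so the support lemma applies to each
      representative.\<close>
    have "regular_class G S \<alpha> F C"
      unfolding regular_class_def
    proof (intro ballI, clarify)
      fix a s r assume "(a, s) \<in> C" and r: "r \<in> centralizer G S s" "r \<in> conj_subgroup G F a"
      then obtain t where t: "t \<in> S" "a = inv (t \<otimes> g)" "s = t \<otimes> u \<otimes> inv t"
        using g by (auto simp: C_def balanced_rel_def inv_mult_group)
      have "x (t \<otimes> g) s = \<chi> t u * x g u"
        using x t g u galois_equivariant by (simp add: invariants_iff)
      then have "x (t \<otimes> g) s \<noteq> 0"
        using nz t u by simp
      then show "\<alpha> s r = \<alpha> r s"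
        using x t g u r by (intro invariant_support_regular[of x "t \<otimes> g"]) auto
    qed
    then have "conj_subgroup G F (inv g) \<subseteq> centralizer G (carrier G) u"
      using R C mem by blast
    then have "g \<otimes> f \<otimes> inv g \<in> centralizer G (carrier G) u"
      using f g by (auto simp: conj_subgroup_def)
    then have "g \<otimes> f \<otimes> inv g \<otimes> u = u \<otimes> (g \<otimes> f \<otimes> inv g)"
      by (simp add: centralizer_def)
    then have "inv f \<otimes> inv g \<otimes> (u \<otimes> (g \<otimes> f \<otimes> inv g)) \<otimes> g
        = inv f \<otimes> inv g \<otimes> (g \<otimes> f \<otimes> inv g \<otimes> u) \<otimes> g"
      by simp
    then show "inv f \<otimes> (inv g \<otimes> u \<otimes> g) \<otimes> f = inv g \<otimes> u \<otimes> g"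
      using f g u by (simp add: m_assoc)
  qed
qed

end

end

theorem theorem5p1:
  fixes G :: "('g, 'm) monoid_scheme"
    and \<alpha> :: "'g \<Rightarrow> 'g \<Rightarrow> 'k :: {alg_closed_field, field_char_0}"
    and A :: "('k, 'g \<Rightarrow> 'g \<Rightarrow> 'k) module"
  assumes "group G" and "finite (carrier G)"
    and "subgroup S G"
    and "two_cocycle G S \<alpha>" and "normalized_cocycle G S \<alpha>" and "nondegenerate_cocycle G S \<alpha>"
    and "subgroup F G"
  defines "A \<equiv> galois_object G S \<alpha>"
  shows "submodule (invariants A (translate G) F) (function_algebra G)
           (miyashita_ulbrich_module G A (translate G))
     \<longleftrightarrow> (\<forall>C \<in> balanced_product G S. regular_class G S \<alpha> F C \<longrightarrow>
           (\<forall>(g, s) \<in> C. conj_subgroup G F g \<subseteq> centralizer G (carrier G) s))"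
proof -
  interpret nondegenerate_cocycle_on_subgroup G S \<alpha>
    using assms by (simp add: nondegenerate_cocycle_on_subgroup_def cocycle_on_subgroup_def
        cocycle_on_subgroup_axioms_def nondegenerate_cocycle_on_subgroup_axioms_def)
  show ?thesis
    unfolding A_def using \<open>subgroup F G\<close> by (rule invariants_submodule_iff)
qed

end
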